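(* Let $m\ge1$. For $k\ge5$, the terms of degree $k-3$ in $(-1)^kF_k(\mathbf p;-\mathbf q)$ are $\mathbf p,\mathbf q$-positive; that is, the homogeneous component of degree $k-3$ of the polynomial $(-1)^kF_k(\mathbf p;-\mathbf q)$ is $\mathbf p,\mathbf q$-positive.
   Context: Fix $m\ge1$ and indeterminates $\mathbf p=(p_1,\dots,p_m)$, $\mathbf q=(q_1,\dots,q_m)$; write $-\mathbf q=(-q_1,\dots,-q_m)$. "Degree" is total degree in the $p$'s and $q$'s. Normalized character: for partitions $\omega\vdash n$ and $1\le k\le n$, $\widehat\chi_\omega(k\,1^{n-k})=n(n-1)\cdots(n-k+1)\,\chi_\omega(k\,1^{n-k})/\chi_\omega(1^n)$, where $\chi_\omega(\lambda)$ is the irreducible character of the symmetric group $\mathfrak S_n$ indexed by $\omega$ evaluated on the class of cycle type $\lambda$, and $k\,1^{n-k}$ is the cycle type of a $k$-cycle. Shape $\mathbf p\times\mathbf q$: for positive integers $p_1,\dots,p_m$ and integers $q_1>q_2>\cdots>q_m>0$, $\mathbf p\times\mathbf q$ is the partition of $n=\sum_i p_iq_i$ having exactly $p_i$ parts equal to $q_i$ for $i=1,\dots,m$. Stanley's character polynomial $F_k(\mathbf p;\mathbf q)$ is the (unique) polynomial in the $p$'s and $q$'s with $F_k(\mathbf p;\mathbf q)=\widehat\chi_{\mathbf p\times\mathbf q}(k\,1^{n-k})$ for all such integer values with $n\ge k$. $F_k(\mathbf p;-\mathbf q)$ is obtained by replacing each $q_i$ by $-q_i$. A polynomial in the $p$'s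 and $q$'s is called $\mathbf p,\mathbf q$-positive if the coefficients of all its terms (i.e. all its nonzero coefficients) are positive. *)

theory Defs
  imports
    Complex_Main
    "HOL-Library.Function_Algebras"
    "HOL-Library.Poly_Mapping"
    "HOL-Combinatorics.Combinatorics"
begin

section \<open>Irreducible characters of the symmetric groups\<close>

text \<open>
  The symmetric group on \<open>n\<close> letters consists of the \<open>\<sigma> :: nat \<Rightarrow> nat\<close> with \<open>\<sigma> permutes {..<n}\<close>.
  Its complex group algebra consists of the functions from \<open>nat \<Rightarrow> nat\<close> to the complex numbers
  that vanish off the group; the value at \<open>\<sigma>\<close> is the coefficient of \<open>\<sigma>\<close>.
\<close>

interpretation cfun: vector_space "\<lambda>(c::complex) (f :: 'a \<Rightarrow> complex) x. c * f x"
  by unfold_locales (auto simp: fun_eq_iff algebra_simps)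

definition group_algebra :: "nat \<Rightarrow> ((nat \<Rightarrow> nat) \<Rightarrow> complex) set" where
  "group_algebra n = {f. \<forall>\<sigma>. \<not> \<sigma> permutes {..<n} \<longrightarrow> f \<sigma> = 0}"

definition galg_mult ::
  "nat \<Rightarrow> ((nat \<Rightarrow> nat) \<Rightarrow> complex) \<Rightarrow> ((nat \<Rightarrow> nat) \<Rightarrow> complex) \<Rightarrow> (nat \<Rightarrow> nat) \<Rightarrow> complex" where
  "galg_mult n f g = (\<lambda>\<sigma>. \<Sum>\<tau> | \<tau> permutes {..<n}. f \<tau> * g (inv \<tau> \<circ> \<sigma>))"

definition left_translate ::
  "(nat \<Rightarrow> nat) \<Rightarrow> ((nat \<Rightarrow> nat) \<Rightarrow> complex) \<Rightarrow> (nat \<Rightarrow> nat) \<Rightarrow> complex" where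
  "left_translate \<sigma> f = (\<lambda>\<tau>. f (inv \<sigma> \<circ> \<tau>))"

text \<open>Meaningful when \<open>V\<close> is a finite-dimensional subspace with \<open>T ` V \<subseteq> V\<close>.\<close>

definition trace_on ::
  "('a \<Rightarrow> complex) set \<Rightarrow> (('a \<Rightarrow> complex) \<Rightarrow> ('a \<Rightarrow> complex)) \<Rightarrow> complex" where
  "trace_on V T =
     (let B = (SOME B. cfun.independent B \<and> cfun.span B = V)
      in \<Sum>b\<in>B. cfun.representation B (T b) b)"

text \<open>
  A partition is the weakly decreasing list of its positive parts.
  The tableau of shape \<open>\<omega>\<close> with entries \<open>0, 1, \<dots>\<close> filled in row by row, given as the
  map from an entry to its cell (row, column).
\<close>

definition tableau :: "nat list \<Rightarrow> nat \<Rightarrow> nat \<times> nat" where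
  "tableau \<omega> x = [(i, j). i \<leftarrow> [0..<length \<omega>], j \<leftarrow> [0..<\<omega> ! i]] ! x"

definition row_group :: "nat list \<Rightarrow> (nat \<Rightarrow> nat) set" where
  "row_group \<omega> = {\<sigma>. \<sigma> permutes {..<sum_list \<omega>} \<and>
     (\<forall>x<sum_list \<omega>. fst (tableau \<omega> (\<sigma> x)) = fst (tableau \<omega> x))}"

definition column_group :: "nat list \<Rightarrow> (nat \<Rightarrow> nat) set" where
  "column_group \<omega> = {\<sigma>. \<sigma> permutes {..<sum_list \<omega>} \<and>
     (\<forall>x<sum_list \<omega>. snd (tableau \<omega> (\<sigma> x)) = snd (tableau \<omega> x))}"

definition young_symmetrizer :: "nat list \<Rightarrow> (nat \<Rightarrow> nat) \<Rightarrow> complex" where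
  "young_symmetrizer \<omega> =
     galg_mult (sum_list \<omega>)
       (\<lambda>\<sigma>. if \<sigma> \<in> row_group \<omega> then 1 else 0)
       (\<lambda>\<sigma>. if \<sigma> \<in> column_group \<omega> then of_int (sign \<sigma>) else 0)"

text \<open>
  The irreducible (Specht) module indexed by \<open>\<omega>\<close>, as the left ideal generated by the Young
  symmetrizer; the trivial module belongs to \<open>[n]\<close>, the sign module to the shape with \<open>n\<close>
  parts equal to 1.
\<close>

definition specht_module :: "nat list \<Rightarrow> ((nat \<Rightarrow> nat) \<Rightarrow> complex) set" where
  "specht_module \<omega> =
     (\<lambda>f. galg_mult (sum_list \<omega>) f (young_symmetrizer \<omega>)) ` group_algebra (sum_list \<omega>)"

definition irr_character :: "nat list \<Rightarrow> (nat \<Rightarrow> nat) \<Rightarrow> complex" where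
  "irr_character \<omega> \<sigma> = trace_on (specht_module \<omega>) (left_translate \<sigma>)"

text \<open>
  The character on the class of cycle type \<open>k 1\<^sup>n\<^sup>-\<^sup>k\<close> is evaluated at the \<open>k\<close>-cycle
  \<open>(0 1 \<dots> k-1)\<close>; used for partitions of \<open>n\<close> with \<open>1 \<le> k \<le> n\<close>.
\<close>

definition normalized_character :: "nat list \<Rightarrow> nat \<Rightarrow> complex" where
  "normalized_character \<omega> k =
     (\<Prod>i<k. of_nat (sum_list \<omega>) - of_nat i) *
     irr_character \<omega> (cycle_of_list [0..<k]) / irr_character \<omega> id"

section \<open>Polynomials in the indeterminates p and q\<close>

datatype pq_var = P nat | Q nat

text \<open>A polynomial maps monomials (finitely supported exponent vectors) to coefficients.\<close>

type_synonym pq_monomial = "pq_var \<Rightarrow>\<^sub>0 nat"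
type_synonym pq_poly = "pq_monomial \<Rightarrow>\<^sub>0 real"

definition pq_indets :: "nat \<Rightarrow> pq_var set" where
  "pq_indets m = P ` {1..m} \<union> Q ` {1..m}"

definition pq_polys :: "nat \<Rightarrow> pq_poly set" where
  "pq_polys m = {F. \<forall>\<mu>\<in>Poly_Mapping.keys F. Poly_Mapping.keys \<mu> \<subseteq> pq_indets m}"

text \<open>
  Substitution of \<open>v\<close> for the indeterminates, coefficients being mapped along the ring
  homomorphism \<open>\<phi>\<close>.
\<close>

definition poly_subst :: "(real \<Rightarrow> 'b::comm_ring_1) \<Rightarrow> (pq_var \<Rightarrow> 'b) \<Rightarrow> pq_poly \<Rightarrow> 'b" where
  "poly_subst \<phi> v F =
     (\<Sum>\<mu>\<in>Poly_Mapping.keys F.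
        \<phi> (Poly_Mapping.lookup F \<mu>) *
        (\<Prod>x\<in>Poly_Mapping.keys \<mu>. v x ^ Poly_Mapping.lookup \<mu> x))"

definition pq_eval :: "(nat \<Rightarrow> nat) \<Rightarrow> (nat \<Rightarrow> nat) \<Rightarrow> pq_poly \<Rightarrow> complex" where
  "pq_eval p q =
     poly_subst complex_of_real (\<lambda>x. case x of P i \<Rightarrow> of_nat (p i) | Q i \<Rightarrow> of_nat (q i))"

definition pq_Const :: "real \<Rightarrow> pq_poly" where
  "pq_Const c = Poly_Mapping.single 0 c"

definition pq_Var :: "pq_var \<Rightarrow> pq_poly" where
  "pq_Var x = Poly_Mapping.single (Poly_Mapping.single x 1) 1"

definition negate_q :: "pq_poly \<Rightarrow> pq_poly" where
  "negate_q = poly_subst pq_Const (\<lambda>x. case x of P i \<Rightarrow> pq_Var (P i) | Q i \<Rightarrow> - pq_Var (Q i))"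

definition total_degree :: "pq_monomial \<Rightarrow> nat" where
  "total_degree \<mu> = (\<Sum>x\<in>Poly_Mapping.keys \<mu>. Poly_Mapping.lookup \<mu> x)"

definition hom_component :: "nat \<Rightarrow> pq_poly \<Rightarrow> pq_poly" where
  "hom_component d F =
     (\<Sum>\<mu> | \<mu> \<in> Poly_Mapping.keys F \<and> total_degree \<mu> = d.
        Poly_Mapping.single \<mu> (Poly_Mapping.lookup F \<mu>))"

definition pq_positive :: "pq_poly \<Rightarrow> bool" where
  "pq_positive F \<longleftrightarrow> (\<forall>\<mu>\<in>Poly_Mapping.keys F. 0 < Poly_Mapping.lookup F \<mu>)"

section \<open>Stanley's character polynomials\<close>

definition pq_shape :: "nat \<Rightarrow> (nat \<Rightarrow> nat) \<Rightarrow> (nat \<Rightarrow> nat) \<Rightarrow> nat list" where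
  "pq_shape m p q = concat (map (\<lambda>i. replicate (p i) (q i)) [1..<Suc m])"

definition is_stanley_poly :: "nat \<Rightarrow> nat \<Rightarrow> pq_poly \<Rightarrow> bool" where
  "is_stanley_poly m k F \<longleftrightarrow>
     F \<in> pq_polys m \<and>
     (\<forall>p q. (\<forall>i\<in>{1..m}. 0 < p i \<and> 0 < q i) \<and>
            (\<forall>i\<in>{1..m}. \<forall>j\<in>{1..m}. i < j \<longrightarrow> q j < q i) \<and>
            k \<le> (\<Sum>i=1..m. p i * q i) \<longrightarrow>
        pq_eval p q F = normalized_character (pq_shape m p q) k)"

definition stanley_poly :: "nat \<Rightarrow> nat \<Rightarrow> pq_poly" where
  "stanley_poly m k = (THE F. is_stanley_poly m k F)"

end

theory Submission
  imports Defs "HOL-Computational_Algebra.Polynomial"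
begin

text \<open>
  The coefficients in all degrees are nonnegative, by the Stanley-Feray formula. Following Feray
  and Sniady, write the Young symmetrizer as \<open>c = a b\<close>; since \<open>c\<close> squares to a multiple of itself,
  the normalized character at \<open>\<pi>\<close> is an average of the coefficients of \<open>c\<close> over the conjugates of
  \<open>\<pi>\<^sup>-\<^sup>1\<close>. Expanding \<open>c\<close>, it becomes a signed sum over the factorisations \<open>\<pi>\<^sup>-\<^sup>1 = \<rho> \<sigma>\<close> in
  the symmetric group on \<open>k\<close> letters of the number of injections of the \<open>k\<close> letters into the cells
  whose row is constant on the cycles of \<open>\<rho>\<close> and whose column is constant on the cycles of \<open>\<sigma>\<close>;
  a sign-reversing involution removes the injectivity condition. For the shape \<open>p \<times> q\<close> the number
  of these maps is a sum over colourings \<open>\<phi>\<close> of the cycles of \<open>\<rho>\<close> by blocks of equal rows, a cycle of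
  \<open>\<rho>\<close> contributing the factor \<open>p\<^sub>i\<close> of its colour and a cycle of \<open>\<sigma>\<close> the factor \<open>q\<^sub>i\<close> of the
  largest colour it meets. The sign of \<open>\<sigma>\<close> is \<open>(-1)\<^sup>k\<close> times \<open>-1\<close> to the number of its cycles, so it
  cancels against the signs in \<open>(-1)\<^sup>k F\<^sub>k(p; -q)\<close>.
\<close>

section \<open>Traces on left ideals of the group algebra\<close>

lemma sum_apply: "(\<Sum>i\<in>A. f i) x = (\<Sum>i\<in>A. f i x)"
  by (induction A rule: infinite_finite_induct) auto

text \<open>The operator \<open>f \<mapsto> (\<Sum>g\<in>G. f g * K g)\<close> on functions
  supported on \<open>G\<close> maps into \<open>V\<close> and acts on \<open>V\<close> as
  \<open>\<alpha>\<close> times \<open>T\<close>. An operator has the same trace as its restriction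
  to a subspace containing its image. Concretely, the double sum of \<open>b g * r (K g) b\<close>
  is evaluated in both orders: summing over \<open>g\<close> first gives the trace on
  \<open>V\<close>, summing over \<open>b\<close> first gives the diagonal entries
  \<open>K g g\<close>.\<close>

lemma trace_on_eq_sum:
  fixes V :: "('a \<Rightarrow> complex) set"
  assumes V: "cfun.subspace V" and G: "finite G"
    and supp: "\<And>v x. v \<in> V \<Longrightarrow> x \<notin> G \<Longrightarrow> v x = 0"
    and K: "\<And>g. g \<in> G \<Longrightarrow> K g \<in> V"
    and T: "\<And>v. v \<in> V \<Longrightarrow> T v \<in> V"
    and KT: "\<And>v x. v \<in> V \<Longrightarrow> (\<Sum>g\<in>G. v g * K g x) = \<alpha> * T v x"
  shows "(\<Sum>g\<in>G. K g g) = \<alpha> * trace_on V T"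
proof -
  define B where "B = (SOME B. cfun.independent B \<and> cfun.span B = V)"
  obtain B0 where "B0 \<subseteq> V" "cfun.independent B0" "V \<subseteq> cfun.span B0"
    by (rule cfun.maximal_independent_subset)
  with V have "\<exists>B. cfun.independent B \<and> cfun.span B = V"
    using cfun.span_subspace by blast
  then have B: "cfun.independent B" "cfun.span B = V"
    unfolding B_def by (metis (mono_tags, lifting) someI_ex)+
  have BV: "b \<in> V" if "b \<in> B" for b using that B(2) cfun.span_base by blast
  \<comment> \<open>The finitely many point masses span every function supported on
    \<open>G\<close>. The independent set \<open>B\<close>, chosen by \<open>SOME\<close>, is
    therefore finite.\<close>
  define \<delta> :: "'a \<Rightarrow> 'a \<Rightarrow> complex" where "\<delta> = (\<lambda>g x. if x = g then 1 else 0)"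
  have "v \<in> cfun.span (\<delta> ` G)" if "v \<in> V" for v
  proof -
    have vx: "v x = (\<Sum>g\<in>G. v g * \<delta> g x)" for x
      using supp[OF that] G by (simp add: \<delta>_def if_distrib cong: if_cong)
    have "v = (\<Sum>g\<in>G. (\<lambda>x. v g * \<delta> g x))"
      by (rule ext, subst sum_apply) (rule vx)
    also have "\<dots> \<in> cfun.span (\<delta> ` G)"
      by (intro cfun.span_sum cfun.span_scale cfun.span_base) auto
    finally show ?thesis .
  qed
  with BV have finB: "finite B"
    using cfun.independent_span_bound[of "\<delta> ` G" B] G B(1) by blast
  define r where "r = cfun.representation B"
  have r: "(\<Sum>b\<in>B. r v b * b x) = v x" if "v \<in> V" for v x
  proof -
    have "(\<Sum>b\<in>B. (\<lambda>x. r v b * b x)) = v"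
      unfolding r_def using that B finB by (intro cfun.sum_representation_eq) auto
    then show ?thesis by (metis (no_types, lifting) sum_apply sum.cong)
  qed
  have "\<alpha> * r (T b) b = (\<Sum>g\<in>G. b g * r (K g) b)" if "b \<in> B" for b
  proof -
    have bV: "b \<in> V" using BV that .
    have eq: "(\<lambda>x. \<alpha> * T b x) = (\<Sum>g\<in>G. (\<lambda>x. b g * K g x))"
      by (intro ext, subst sum_apply) (simp add: KT[OF bV])
    have "\<alpha> * r (T b) b = r (\<lambda>x. \<alpha> * T b x) b"
      unfolding r_def using B T[OF bV] by (subst cfun.representation_scale) auto
    also have "\<dots> = (\<Sum>g\<in>G. r (\<lambda>x. b g * K g x) b)"
      unfolding eq r_def using B K by (subst cfun.representation_sum) (auto simp: cfun.subspace_scale[OF V])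
    also have "\<dots> = (\<Sum>g\<in>G. b g * r (K g) b)"
      unfolding r_def using B K by (intro sum.cong refl, subst cfun.representation_scale) auto
    finally show ?thesis .
  qed
  then have "\<alpha> * trace_on V T = (\<Sum>b\<in>B. \<Sum>g\<in>G. b g * r (K g) b)"
    by (simp add: trace_on_def B_def[symmetric] Let_def sum_distrib_left r_def)
  also have "\<dots> = (\<Sum>g\<in>G. \<Sum>b\<in>B. r (K g) b * b g)"
    by (subst sum.swap) (simp add: mult.commute)
  also have "\<dots> = (\<Sum>g\<in>G. K g g)"
    by (intro sum.cong refl r K)
  finally show ?thesis by simp
qed

section \<open>Reindexing sums over a symmetric group\<close>

lemma bij_betw_comp_left_permutes:
  assumes "\<sigma> permutes S" shows "bij_betw (\<lambda>\<tau>. \<sigma> \<circ> \<tau>) {\<tau>. \<tau> permutes S} {\<tau>. \<tau> permutes S}"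
  by (rule bij_betwI[where g = "\<lambda>\<tau>. inv \<sigma> \<circ> \<tau>"])
    (use assms in \<open>auto simp: permutes_compose permutes_inv comp_assoc[symmetric] permutes_inv_o\<close>)

lemma bij_betw_comp_right_permutes:
  assumes "\<sigma> permutes S" shows "bij_betw (\<lambda>\<tau>. \<tau> \<circ> \<sigma>) {\<tau>. \<tau> permutes S} {\<tau>. \<tau> permutes S}"
  by (rule bij_betwI[where g = "\<lambda>\<tau>. \<tau> \<circ> inv \<sigma>"])
    (use assms in \<open>auto simp: permutes_compose permutes_inv comp_assoc permutes_inv_o\<close>)

lemma bij_betw_inv_permutes: "bij_betw inv {\<tau>. \<tau> permutes S} {\<tau>. \<tau> permutes S}"
  by (rule bij_betwI[where g = inv]) (auto simp: permutes_inv permutes_inv_inv)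

lemma inv_comp_permutes:
  "\<sigma> permutes S \<Longrightarrow> \<tau> permutes S \<Longrightarrow> inv (\<sigma> \<circ> \<tau>) = inv \<tau> \<circ> inv \<sigma>"
  by (simp add: o_inv_distrib permutes_bij)

lemma comp_permutes_iff:
  assumes "\<sigma> permutes S" shows "(\<sigma> \<circ> \<tau>) permutes S \<longleftrightarrow> \<tau> permutes S"
proof
  assume "(\<sigma> \<circ> \<tau>) permutes S"
  then have "(inv \<sigma> \<circ> (\<sigma> \<circ> \<tau>)) permutes S"
    using assms by (metis permutes_compose permutes_inv)
  then show "\<tau> permutes S" by (metis assms comp_assoc id_comp permutes_inv_o(2))
qed (use assms permutes_compose in blast)

section \<open>Convolution and left translation in the group algebra\<close>

lemma galg_mult_assoc:
  "galg_mult n (galg_mult n f g) h = galg_mult n f (galg_mult n g h)"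
proof
  fix \<sigma>
  let ?S = "{\<tau>. \<tau> permutes {..<n}}"
  have "galg_mult n (galg_mult n f g) h \<sigma> = (\<Sum>\<rho>\<in>?S. \<Sum>\<tau>\<in>?S. f \<rho> * g (inv \<rho> \<circ> \<tau>) * h (inv \<tau> \<circ> \<sigma>))"
    unfolding galg_mult_def sum_distrib_right by (rule sum.swap)
  also have "\<dots> = (\<Sum>\<rho>\<in>?S. f \<rho> * (\<Sum>\<tau>\<in>?S. g \<tau> * h (inv \<tau> \<circ> (inv \<rho> \<circ> \<sigma>))))"
  proof (rule sum.cong[OF refl])
    fix \<rho> assume "\<rho> \<in> ?S"
    then have \<rho>: "\<rho> permutes {..<n}" by simp
    have "(\<Sum>\<tau>\<in>?S. f \<rho> * g (inv \<rho> \<circ> \<tau>) * h (inv \<tau> \<circ> \<sigma>))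
      = (\<Sum>\<tau>\<in>?S. f \<rho> * g (inv \<rho> \<circ> (\<rho> \<circ> \<tau>)) * h (inv (\<rho> \<circ> \<tau>) \<circ> \<sigma>))"
      by (rule sum.reindex_bij_betw[OF bij_betw_comp_left_permutes[OF \<rho>], symmetric])
    also have "\<dots> = (\<Sum>\<tau>\<in>?S. f \<rho> * (g \<tau> * h (inv \<tau> \<circ> (inv \<rho> \<circ> \<sigma>))))"
      by (intro sum.cong refl) (use \<rho> in \<open>auto simp: inv_comp_permutes comp_assoc[symmetric] permutes_inv_o\<close>)
    finally show "(\<Sum>\<tau>\<in>?S. f \<rho> * g (inv \<rho> \<circ> \<tau>) * h (inv \<tau> \<circ> \<sigma>))
      = f \<rho> * (\<Sum>\<tau>\<in>?S. g \<tau> * h (inv \<tau> \<circ> (inv \<rho> \<circ> \<sigma>)))"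
      by (simp add: sum_distrib_left)
  qed
  finally show "galg_mult n (galg_mult n f g) h \<sigma> = galg_mult n f (galg_mult n g h) \<sigma>"
    unfolding galg_mult_def .
qed

lemma galg_mult_closed:
  assumes "g \<in> group_algebra n" shows "galg_mult n f g \<in> group_algebra n"
  unfolding group_algebra_def galg_mult_def
proof (intro CollectI allI impI sum.neutral ballI)
  fix \<sigma> \<tau> assume "\<not> \<sigma> permutes {..<n}" "\<tau> \<in> {\<tau>. \<tau> permutes {..<n}}"
  then have "\<not> (inv \<tau> \<circ> \<sigma>) permutes {..<n}"
    by (simp add: comp_permutes_iff permutes_inv)
  with assms show "f \<tau> * g (inv \<tau> \<circ> \<sigma>) = 0" by (simp add: group_algebra_def)
qed

lemma left_translate_galg_mult:
  assumes "\<pi> permutes {..<n}"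
  shows "left_translate \<pi> (galg_mult n f g) = galg_mult n (left_translate \<pi> f) g"
proof
  fix \<sigma>
  let ?S = "{\<tau>. \<tau> permutes {..<n}}"
  have "galg_mult n (left_translate \<pi> f) g \<sigma> = (\<Sum>\<tau>\<in>?S. f (inv \<pi> \<circ> (\<pi> \<circ> \<tau>)) * g (inv (\<pi> \<circ> \<tau>) \<circ> \<sigma>))"
    unfolding galg_mult_def left_translate_def
    by (rule sum.reindex_bij_betw[OF bij_betw_comp_left_permutes[OF assms], symmetric])
  also have "\<dots> = left_translate \<pi> (galg_mult n f g) \<sigma>"
    unfolding galg_mult_def left_translate_def
    by (intro sum.cong refl) (use assms in \<open>auto simp: inv_comp_permutes comp_assoc[symmetric] permutes_inv_o\<close>)
  finally show "left_translate \<pi> (galg_mult n f g) \<sigma> = galg_mult n (left_translate \<pi> f) g \<sigma>" ..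
qed

lemma galg_mult_delta:
  assumes "g permutes {..<n}"
  shows "galg_mult n (\<lambda>\<tau>. if \<tau> = g then 1 else 0) f = (\<lambda>\<sigma>. f (inv g \<circ> \<sigma>))"
proof
  fix \<sigma>
  have "galg_mult n (\<lambda>\<tau>. if \<tau> = g then 1 else 0) f \<sigma> =
    (\<Sum>\<tau> | \<tau> permutes {..<n}. if \<tau> = g then f (inv \<tau> \<circ> \<sigma>) else 0)"
    unfolding galg_mult_def by (intro sum.cong) auto
  with assms show "galg_mult n (\<lambda>\<tau>. if \<tau> = g then 1 else 0) f \<sigma> = f (inv g \<circ> \<sigma>)"
    by (simp add: finite_permutations)
qed

text \<open>The trace of the operator \<open>f \<mapsto> \<pi> f c\<close> on the group algebra is computed in two ways:
  in the basis of permutations, and on its image, where right multiplication by \<open>c\<close> is the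
  scalar \<open>\<alpha>\<close>.\<close>

lemma trace_left_ideal:
  assumes c: "c \<in> group_algebra n" and cc: "galg_mult n c c = (\<lambda>\<sigma>. \<alpha> * c \<sigma>)"
    and \<pi>: "\<pi> permutes {..<n}"
  shows "(\<Sum>g | g permutes {..<n}. c (inv g \<circ> inv \<pi> \<circ> g)) =
    \<alpha> * trace_on ((\<lambda>f. galg_mult n f c) ` group_algebra n) (left_translate \<pi>)"
proof -
  let ?V = "(\<lambda>f. galg_mult n f c) ` group_algebra n"
  \<comment> \<open>As a function of \<open>\<sigma>\<close>,
    \<open>c (inv g \<circ> inv \<pi> \<circ> \<sigma>)\<close> is the element
    \<open>\<pi> g c\<close>, the image of the point mass at \<open>g\<close>.\<close>
  have "(\<Sum>g | g permutes {..<n}. (\<lambda>\<sigma>. c (inv g \<circ> inv \<pi> \<circ> \<sigma>)) g) = \<alpha> * trace_on ?V (left_translate \<pi>)"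
  proof (rule trace_on_eq_sum[where K = "\<lambda>g \<sigma>. c (inv g \<circ> inv \<pi> \<circ> \<sigma>)"])
    show "cfun.subspace ?V"
    proof (rule cfun.subspaceI)
      have "galg_mult n 0 c = 0" by (auto simp: galg_mult_def fun_eq_iff)
      then show "0 \<in> ?V" by (intro image_eqI[of _ _ 0]) (auto simp: group_algebra_def)
    next
      fix x y assume "x \<in> ?V" "y \<in> ?V"
      then obtain f g where f: "f \<in> group_algebra n" "x = galg_mult n f c"
        and g: "g \<in> group_algebra n" "y = galg_mult n g c" by auto
      have "x + y = galg_mult n (f + g) c"
        by (auto simp: f(2) g(2) galg_mult_def fun_eq_iff sum.distrib algebra_simps)
      moreover have "f + g \<in> group_algebra n" using f(1) g(1) by (simp add: group_algebra_def)
      ultimately show "x + y \<in> ?V" by blast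
    next
      fix a x assume "x \<in> ?V"
      then obtain f where f: "f \<in> group_algebra n" "x = galg_mult n f c" by auto
      have "(\<lambda>\<sigma>. a * x \<sigma>) = galg_mult n (\<lambda>\<sigma>. a * f \<sigma>) c"
        by (auto simp: f(2) galg_mult_def fun_eq_iff sum_distrib_left algebra_simps)
      moreover have "(\<lambda>\<sigma>. a * f \<sigma>) \<in> group_algebra n" using f(1) by (simp add: group_algebra_def)
      ultimately show "(\<lambda>\<sigma>. a * x \<sigma>) \<in> ?V" by blast
    qed
    show "finite {g. g permutes {..<n}}" by (simp add: finite_permutations)
    show "v x = 0" if "v \<in> ?V" "x \<notin> {g. g permutes {..<n}}" for v x
      using that galg_mult_closed[OF c] by (auto simp: group_algebra_def)
    show "(\<lambda>\<sigma>. c (inv g \<circ> inv \<pi> \<circ> \<sigma>)) \<in> ?V" if "g \<in> {g. g permutes {..<n}}" for g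
    proof (rule image_eqI)
      have pg: "(\<pi> \<circ> g) permutes {..<n}" using that \<pi> by (simp add: permutes_compose)
      show "(\<lambda>\<sigma>. c (inv g \<circ> inv \<pi> \<circ> \<sigma>)) = galg_mult n (\<lambda>\<tau>. if \<tau> = \<pi> \<circ> g then 1 else 0) c"
        using galg_mult_delta[OF pg, of c] that \<pi> by (simp add: inv_comp_permutes)
      show "(\<lambda>\<tau>. if \<tau> = \<pi> \<circ> g then 1 else 0) \<in> group_algebra n"
        using pg by (auto simp: group_algebra_def)
    qed
    show "left_translate \<pi> v \<in> ?V" if "v \<in> ?V" for v
    proof -
      obtain f where f: "f \<in> group_algebra n" "v = galg_mult n f c" using \<open>v \<in> ?V\<close> by auto
      have "left_translate \<pi> f \<in> group_algebra n"
        using f(1) \<pi> by (auto simp: group_algebra_def left_translate_def comp_permutes_iff permutes_inv)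
      with f(2) left_translate_galg_mult[OF \<pi>] show ?thesis by auto
    qed
    show "(\<Sum>g | g permutes {..<n}. v g * c (inv g \<circ> inv \<pi> \<circ> \<sigma>)) = \<alpha> * left_translate \<pi> v \<sigma>"
      if "v \<in> ?V" for v \<sigma>
    proof -
      obtain f where f: "v = galg_mult n f c" using \<open>v \<in> ?V\<close> by auto
      have "(\<Sum>g | g permutes {..<n}. v g * c (inv g \<circ> inv \<pi> \<circ> \<sigma>)) = galg_mult n v c (inv \<pi> \<circ> \<sigma>)"
        by (simp add: galg_mult_def comp_assoc)
      also have "galg_mult n v c = galg_mult n f (galg_mult n c c)"
        unfolding f by (rule galg_mult_assoc)
      also have "\<dots> = (\<lambda>\<sigma>. \<alpha> * v \<sigma>)"
        unfolding cc f by (auto simp: galg_mult_def fun_eq_iff sum_distrib_left algebra_simps)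
      finally show ?thesis by (simp only: left_translate_def)
    qed
  qed
  then show ?thesis .
qed

section \<open>Young symmetrizers\<close>

definition cells :: "nat list \<Rightarrow> (nat \<times> nat) set" where
  "cells \<omega> = {(i, j). i < length \<omega> \<and> j < \<omega> ! i}"

abbreviation row :: "nat list \<Rightarrow> nat \<Rightarrow> nat" where "row \<omega> x \<equiv> fst (tableau \<omega> x)"
abbreviation col :: "nat list \<Rightarrow> nat \<Rightarrow> nat" where "col \<omega> x \<equiv> snd (tableau \<omega> x)"

lemma bij_betw_tableau: "bij_betw (tableau \<omega>) {..<sum_list \<omega>} (cells \<omega>)"
proof -
  define xs where "xs = [(i, j). i \<leftarrow> [0..<length \<omega>], j \<leftarrow> [0..<\<omega> ! i]]"
  have "length xs = sum_list (map (\<lambda>i. \<omega> ! i) [0..<length \<omega>])"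
    by (simp add: xs_def length_concat comp_def)
  then have len: "length xs = sum_list \<omega>" by (simp add: map_nth)
  have "distinct (concat (map (\<lambda>i. map (Pair i) [0..<\<omega> ! i]) [0..<n]))" for n
    by (induction n) (auto simp: distinct_map inj_on_def)
  then have "distinct xs" by (simp add: xs_def)
  moreover have "set xs = cells \<omega>" by (auto simp: xs_def cells_def)
  ultimately have "bij_betw ((!) xs) {..<length xs} (cells \<omega>)"
    by (intro bij_betw_nth) auto
  moreover have "tableau \<omega> = (!) xs" by (auto simp: fun_eq_iff tableau_def xs_def)
  ultimately show ?thesis by (simp add: len)
qed

lemma finite_cells: "finite (cells \<omega>)"
  using bij_betw_tableau[of \<omega>] bij_betw_finite by blast

lemma row_col_inj:
  assumes "x < sum_list \<omega>" "y < sum_list \<omega>" "row \<omega> x = row \<omega> y" "col \<omega> x = col \<omega> y"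
  shows "x = y"
  using bij_betw_tableau[of \<omega>] assms by (auto simp: bij_betw_def inj_on_def prod_eq_iff)

text \<open>Induction on the rows. Suppose that the rows before \<open>i\<close> agree and that
  \<open>S\<close> has a cell of row \<open>i\<close> outside \<open>D\<close>. By
  \<open>down\<close>, the column of that cell in \<open>D\<close> lies in earlier rows only, so it
  is contained in \<open>S\<close>, and the extra cell makes the column of \<open>S\<close> strictly
  larger. Hence row \<open>i\<close> of \<open>S\<close> lies in row \<open>i\<close> of
  \<open>D\<close>, and the row counts force equality.\<close>

lemma young_diagram_unique:
  fixes D S :: "(nat \<times> nat) set"
  assumes fin: "finite D" "finite S"
    and down: "\<And>i i' j. (i, j) \<in> D \<Longrightarrow> i' \<le> i \<Longrightarrow> (i', j) \<in> D"
    and rows: "\<And>i. card {s \<in> S. fst s = i} = card {d \<in> D. fst d = i}"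
    and cols: "\<And>j. card {s \<in> S. snd s = j} = card {d \<in> D. snd d = j}"
  shows "S = D"
proof -
  have "(i, j) \<in> S \<longleftrightarrow> (i, j) \<in> D" for i j
  proof (induction i arbitrary: j rule: less_induct)
    case (less i)
    have "{s \<in> S. fst s = i} \<subseteq> {d \<in> D. fst d = i}"
    proof (rule subsetI, rule ccontr)
      fix s assume s: "s \<in> {s \<in> S. fst s = i}" "s \<notin> {d \<in> D. fst d = i}"
      obtain j where j: "s = (i, j)" using s(1) by (cases s) auto
      have "{d \<in> D. snd d = j} \<subset> {s \<in> S. snd s = j}"
      proof (rule psubsetI)
        show "{d \<in> D. snd d = j} \<subseteq> {s \<in> S. snd s = j}"
        proof
          fix d assume d: "d \<in> {d \<in> D. snd d = j}"
          obtain i' where i': "d = (i', j)" using d by (cases d) auto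
          have "\<not> i \<le> i'" using d i' s j down[of i' j i] by auto
          then have "i' < i" by simp
          from less.IH[OF this, of j] d i' show "d \<in> {s \<in> S. snd s = j}" by simp
        qed
        have "s \<in> {s \<in> S. snd s = j}" "s \<notin> {d \<in> D. snd d = j}" using s j by simp_all
        then show "{d \<in> D. snd d = j} \<noteq> {s \<in> S. snd s = j}" by blast
      qed
      then have "card {d \<in> D. snd d = j} < card {s \<in> S. snd s = j}"
        by (rule psubset_card_mono[rotated]) (simp add: fin)
      with cols show False by simp
    qed
    then have "{s \<in> S. fst s = i} = {d \<in> D. fst d = i}"
      by (intro card_subset_eq) (auto simp: fin rows)
    then show ?case by (auto simp: set_eq_iff)
  qed
  then show ?thesis by auto
qed

section \<open>The row and column groups\<close>

lemma row_group_iff: "\<sigma> \<in> row_group \<omega> \<longleftrightarrow>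
    \<sigma> permutes {..<sum_list \<omega>} \<and> (\<forall>x<sum_list \<omega>. row \<omega> (\<sigma> x) = row \<omega> x)"
  by (simp add: row_group_def)

lemma column_group_iff: "\<sigma> \<in> column_group \<omega> \<longleftrightarrow>
    \<sigma> permutes {..<sum_list \<omega>} \<and> (\<forall>x<sum_list \<omega>. col \<omega> (\<sigma> x) = col \<omega> x)"
  by (simp add: column_group_def)

lemma permutes_lt: "\<sigma> permutes {..<n} \<Longrightarrow> \<sigma> x < n \<longleftrightarrow> x < (n::nat)"
  using permutes_in_image[of \<sigma> "{..<n}" x] by simp

lemma row_group_permutes: "\<sigma> \<in> row_group \<omega> \<Longrightarrow> \<sigma> permutes {..<sum_list \<omega>}"
  by (simp add: row_group_def)

lemma column_group_permutes: "\<sigma> \<in> column_group \<omega> \<Longrightarrow> \<sigma> permutes {..<sum_list \<omega>}"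
  by (simp add: column_group_def)

lemma row_group_comp: "\<sigma> \<in> row_group \<omega> \<Longrightarrow> \<tau> \<in> row_group \<omega> \<Longrightarrow> \<sigma> \<circ> \<tau> \<in> row_group \<omega>"
  by (simp add: row_group_iff permutes_compose permutes_lt)

lemma row_group_inv:
  assumes "\<sigma> \<in> row_group \<omega>" shows "inv \<sigma> \<in> row_group \<omega>"
proof -
  have p: "\<sigma> permutes {..<sum_list \<omega>}" using assms by (rule row_group_permutes)
  have "row \<omega> (inv \<sigma> x) = row \<omega> x" if "x < sum_list \<omega>" for x
    by (metis assms that row_group_iff permutes_inv[OF p] permutes_lt permutes_inverses(1)[OF p])
  with p show ?thesis by (simp add: row_group_iff permutes_inv)
qed

lemma column_group_comp: "\<sigma> \<in> column_group \<omega> \<Longrightarrow> \<tau> \<in> column_group \<omega> \<Longrightarrow> \<sigma> \<circ> \<tau> \<in> column_group \<omega>"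
  by (simp add: column_group_iff permutes_compose permutes_lt)

lemma column_group_inv:
  assumes "\<sigma> \<in> column_group \<omega>" shows "inv \<sigma> \<in> column_group \<omega>"
proof -
  have p: "\<sigma> permutes {..<sum_list \<omega>}" using assms by (rule column_group_permutes)
  have "col \<omega> (inv \<sigma> x) = col \<omega> x" if "x < sum_list \<omega>" for x
    by (metis assms that column_group_iff permutes_inv[OF p] permutes_lt permutes_inverses(1)[OF p])
  with p show ?thesis by (simp add: column_group_iff permutes_inv)
qed

lemma bij_betw_comp_right_row_group:
  assumes "\<sigma> \<in> row_group \<omega>"
  shows "bij_betw (\<lambda>\<tau>. \<tau> \<circ> \<sigma>) (row_group \<omega>) (row_group \<omega>)"
  by (rule bij_betwI[where g = "\<lambda>\<tau>. \<tau> \<circ> inv \<sigma>"])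
    (use assms row_group_permutes[OF assms] in
      \<open>auto simp: row_group_comp row_group_inv comp_assoc permutes_inv_o\<close>)

text \<open>The map \<open>W\<close> keeps each entry \<open>y\<close> in its column but moves it to
  the row of \<open>g y\<close>. By \<open>sep\<close> it is injective, and its image has as many
  cells in each row and each column as the diagram, so the image is the diagram. Reading
  \<open>W\<close> as a permutation of the entries gives the column permutation
  \<open>\<kappa>\<close>, and what remains of \<open>g\<close> after removing
  \<open>\<kappa>\<close> preserves rows.\<close>

lemma row_column_decomposition:
  assumes sorted: "sorted_wrt (\<ge>) \<omega>" and g: "g permutes {..<sum_list \<omega>}"
    and sep: "\<And>y y'. y < sum_list \<omega> \<Longrightarrow> y' < sum_list \<omega> \<Longrightarrow> y \<noteq> y' \<Longrightarrow>
      col \<omega> y = col \<omega> y' \<Longrightarrow> row \<omega> (g y) \<noteq> row \<omega> (g y')"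
  obtains \<rho> \<kappa> where "\<rho> \<in> row_group \<omega>" "\<kappa> \<in> column_group \<omega>" "g = \<rho> \<circ> \<kappa>"
proof -
  let ?N = "{..<sum_list \<omega>}"
  define W where "W y = (row \<omega> (g y), col \<omega> y)" for y
  have injW: "inj_on W ?N" using sep by (auto simp: inj_on_def W_def)
  have "W ` ?N = cells \<omega>"
  proof (rule young_diagram_unique)
    show "finite (cells \<omega>)" by (rule finite_cells)
    show "finite (W ` ?N)" by simp
    show "(i', j) \<in> cells \<omega>" if "(i, j) \<in> cells \<omega>" "i' \<le> i" for i i' j
    proof -
      have "\<omega> ! i \<le> \<omega> ! i'"
        using sorted that by (cases "i' = i") (auto simp: cells_def sorted_wrt_iff_nth_less)
      with that show ?thesis by (auto simp: cells_def)
    qed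
    have *: "card {d \<in> cells \<omega>. f d = i} = card {y \<in> ?N. f (tableau \<omega> y) = i}"
      for f :: "nat \<times> nat \<Rightarrow> nat" and i
    proof (rule bij_betw_same_card[symmetric])
      show "bij_betw (tableau \<omega>) {y \<in> ?N. f (tableau \<omega> y) = i} {d \<in> cells \<omega>. f d = i}"
        by (rule bij_betw_Collect[OF bij_betw_tableau]) simp
    qed
    have **: "card {s \<in> W ` ?N. f s = i} = card {y \<in> ?N. f (W y) = i}"
      for f :: "nat \<times> nat \<Rightarrow> nat" and i
    proof (rule bij_betw_same_card[symmetric])
      show "bij_betw W {y \<in> ?N. f (W y) = i} {s \<in> W ` ?N. f s = i}"
        by (rule bij_betw_Collect[OF inj_on_imp_bij_betw[OF injW]]) simp
    qed
    show "card {s \<in> W ` ?N. fst s = i} = card {d \<in> cells \<omega>. fst d = i}" for i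
    proof -
      \<comment> \<open>The row counts agree because \<open>g\<close> only permutes the entries. The
        column counts agree because \<open>W\<close> does not change columns.\<close>
      have "bij_betw g {y \<in> ?N. row \<omega> (g y) = i} {y \<in> ?N. row \<omega> y = i}"
        by (rule bij_betwI[where g = "inv g"])
          (use g permutes_inv[OF g] in \<open>auto simp: permutes_lt permutes_inverses\<close>)
      then show ?thesis unfolding * ** by (auto simp: W_def dest: bij_betw_same_card)
    qed
    show "card {s \<in> W ` ?N. snd s = j} = card {d \<in> cells \<omega>. snd d = j}" for j
      unfolding * ** by (simp add: W_def)
  qed
  then have W: "bij_betw W ?N (cells \<omega>)" using injW by (simp add: bij_betw_def)
  define \<kappa> where "\<kappa> y = (if y < sum_list \<omega> then inv_into ?N (tableau \<omega>) (W y) else y)" for y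
  have T\<kappa>: "tableau \<omega> (\<kappa> y) = W y" if "y < sum_list \<omega>" for y
    using that bij_betw_tableau[of \<omega>] W by (auto simp: \<kappa>_def bij_betw_def intro!: f_inv_into_f)
  have "bij_betw (inv_into ?N (tableau \<omega>) \<circ> W) ?N ?N"
    using W bij_betw_inv_into[OF bij_betw_tableau] by (rule bij_betw_trans)
  then have "bij_betw \<kappa> ?N ?N"
    by (rule bij_betw_cong[THEN iffD1, rotated]) (auto simp: \<kappa>_def)
  then have \<kappa>p: "\<kappa> permutes ?N" by (rule bij_imp_permutes) (auto simp: \<kappa>_def)
  have "\<kappa> \<in> column_group \<omega>" using \<kappa>p T\<kappa> by (simp add: column_group_iff W_def)
  moreover have "g \<circ> inv \<kappa> \<in> row_group \<omega>"
    unfolding row_group_iff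
  proof (intro conjI allI impI)
    show "(g \<circ> inv \<kappa>) permutes ?N" using g \<kappa>p by (simp add: permutes_compose permutes_inv)
    fix x assume x: "x < sum_list \<omega>"
    then have "inv \<kappa> x < sum_list \<omega>" using permutes_inv[OF \<kappa>p] by (simp add: permutes_lt)
    from T\<kappa>[OF this] show "row \<omega> ((g \<circ> inv \<kappa>) x) = row \<omega> x"
      using permutes_inverses(1)[OF \<kappa>p] by (simp add: W_def)
  qed
  moreover have "g = (g \<circ> inv \<kappa>) \<circ> \<kappa>" using \<kappa>p by (simp add: comp_assoc permutes_inv_o)
  ultimately show thesis using that by blast
qed

text \<open>This is the signed column factor \<open>b\<close> of the symmetrizer
  \<open>c = a b\<close>, as an element of the group algebra.\<close>

definition column_sign :: "nat list \<Rightarrow> (nat \<Rightarrow> nat) \<Rightarrow> complex" where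
  "column_sign \<omega> \<sigma> = (if \<sigma> \<in> column_group \<omega> then of_int (sign \<sigma>) else 0)"

lemma young_symmetrizer_eq:
  "young_symmetrizer \<omega> \<sigma> = (\<Sum>\<tau>\<in>row_group \<omega>. column_sign \<omega> (inv \<tau> \<circ> \<sigma>))"
  unfolding young_symmetrizer_def galg_mult_def column_sign_def
proof (rule sum.mono_neutral_cong_right)
  show "finite {\<tau>. \<tau> permutes {..<sum_list \<omega>}}" by (simp add: finite_permutations)
  show "row_group \<omega> \<subseteq> {\<tau>. \<tau> permutes {..<sum_list \<omega>}}" by (simp add: row_group_permutes subset_iff)
qed simp_all

lemma column_sign_comp:
  assumes "\<kappa> \<in> column_group \<omega>"
  shows "column_sign \<omega> (\<kappa> \<circ> \<sigma>) = of_int (sign \<kappa>) * column_sign \<omega> \<sigma>"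
proof (cases "\<sigma> \<in> column_group \<omega>")
  case True
  then show ?thesis
    using assms column_group_comp[OF assms True]
    by (simp add: column_sign_def)
      (metis column_group_permutes finite_lessThan permutation_permutes sign_compose of_int_mult)
next
  case False
  have "\<kappa> \<circ> \<sigma> \<notin> column_group \<omega>"
  proof
    assume "\<kappa> \<circ> \<sigma> \<in> column_group \<omega>"
    with assms have "inv \<kappa> \<circ> (\<kappa> \<circ> \<sigma>) \<in> column_group \<omega>"
      by (blast intro: column_group_comp column_group_inv)
    moreover have "inv \<kappa> \<circ> (\<kappa> \<circ> \<sigma>) = \<sigma>"
      using column_group_permutes[OF assms] by (simp add: comp_assoc[symmetric] permutes_inv_o)
    ultimately show False using False by simp
  qed
  with False show ?thesis by (simp add: column_sign_def)
qed

text \<open>Unless \<open>g\<close> is a product of a row and a column permutation, it carries two entries of one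
  column into one row; the transposition of these two entries then shows that the sum equals its
  own negative.\<close>

lemma von_neumann:
  assumes sorted: "sorted_wrt (\<ge>) \<omega>" and g: "g permutes {..<sum_list \<omega>}"
  shows "\<exists>s. \<forall>\<sigma>. (\<Sum>\<tau>\<in>row_group \<omega>. column_sign \<omega> (inv g \<circ> (inv \<tau> \<circ> \<sigma>))) =
    s * young_symmetrizer \<omega> \<sigma>"
proof (cases "\<exists>y<sum_list \<omega>. \<exists>y'<sum_list \<omega>. y \<noteq> y' \<and> col \<omega> y = col \<omega> y' \<and> row \<omega> (g y) = row \<omega> (g y')")
  case True
  then obtain y y' where y: "y < sum_list \<omega>" "y' < sum_list \<omega>" "y \<noteq> y'"
    "col \<omega> y = col \<omega> y'" "row \<omega> (g y) = row \<omega> (g y')" by blast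
  define t where "t = transpose (g y) (g y')"
  define s where "s = transpose y y'"
  have ne: "g y \<noteq> g y'" using y permutes_inj[OF g] by (auto simp: inj_def)
  have t: "t \<in> row_group \<omega>"
    using y g by (auto simp: row_group_iff t_def permutes_lt transpose_def intro!: permutes_swap_id)
  have s: "s \<in> column_group \<omega>"
    using y by (auto simp: column_group_iff s_def transpose_def intro!: permutes_swap_id)
  \<comment> \<open>The row transposition \<open>t\<close> is the conjugate of the column
    transposition \<open>s\<close> by \<open>g\<close>. Absorbing \<open>t\<close> into the row sum
    therefore puts the odd permutation \<open>s\<close> in front of the argument of
    \<open>column_sign\<close>.\<close>
  have st: "inv g \<circ> inv t = s \<circ> inv g"
  proof
    fix x
    have "t (g x) = g (s x)" for x
      using permutes_inj[OF g] by (auto simp: t_def s_def transpose_def inj_def)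
    then have "t x = g (s (inv g x))" by (metis g permutes_inverses(1))
    then show "(inv g \<circ> inv t) x = (s \<circ> inv g) x"
      by (simp add: t_def permutes_inverses(2)[OF g])
  qed
  have "(\<Sum>\<tau>\<in>row_group \<omega>. column_sign \<omega> (inv g \<circ> (inv \<tau> \<circ> \<sigma>))) = 0" (is "?L = 0") for \<sigma>
  proof -
    have "?L = (\<Sum>\<tau>\<in>row_group \<omega>. column_sign \<omega> (inv g \<circ> (inv (\<tau> \<circ> t) \<circ> \<sigma>)))"
      by (rule sum.reindex_bij_betw[OF bij_betw_comp_right_row_group[OF t], symmetric])
    also have "\<dots> = (\<Sum>\<tau>\<in>row_group \<omega>. column_sign \<omega> (s \<circ> (inv g \<circ> (inv \<tau> \<circ> \<sigma>))))"
    proof (intro sum.cong refl)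
      fix \<tau> assume "\<tau> \<in> row_group \<omega>"
      then have "inv (\<tau> \<circ> t) = inv t \<circ> inv \<tau>"
        using t row_group_permutes inv_comp_permutes by blast
      then show "column_sign \<omega> (inv g \<circ> (inv (\<tau> \<circ> t) \<circ> \<sigma>)) = column_sign \<omega> (s \<circ> (inv g \<circ> (inv \<tau> \<circ> \<sigma>)))"
        using st by (metis comp_assoc)
    qed
    also have "\<dots> = - ?L"
      unfolding column_sign_comp[OF s] using y by (simp add: s_def sign_swap_id sum_negf)
    finally show ?thesis by simp
  qed
  then show ?thesis by (intro exI[of _ 0]) simp
next
  case False
  \<comment> \<open>In the remaining case the row sum absorbs \<open>\<rho>\<close>, and
    \<open>\<kappa>\<close> contributes only its sign.\<close>
  obtain \<rho> \<kappa> where d: "\<rho> \<in> row_group \<omega>" "\<kappa> \<in> column_group \<omega>" "g = \<rho> \<circ> \<kappa>"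
    by (rule row_column_decomposition[OF sorted g]) (use False in blast)
  show ?thesis
  proof (intro exI allI)
    fix \<sigma>
    have "(\<Sum>\<tau>\<in>row_group \<omega>. column_sign \<omega> (inv g \<circ> (inv \<tau> \<circ> \<sigma>))) =
      of_int (sign (inv \<kappa>)) * (\<Sum>\<tau>\<in>row_group \<omega>. column_sign \<omega> (inv (\<tau> \<circ> \<rho>) \<circ> \<sigma>))"
      unfolding sum_distrib_left
    proof (intro sum.cong refl)
      fix \<tau> assume "\<tau> \<in> row_group \<omega>"
      then have 1: "inv (\<tau> \<circ> \<rho>) = inv \<rho> \<circ> inv \<tau>"
        using d row_group_permutes inv_comp_permutes by blast
      have 2: "inv g = inv \<kappa> \<circ> inv \<rho>"
        using d row_group_permutes column_group_permutes inv_comp_permutes by blast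
      show "column_sign \<omega> (inv g \<circ> (inv \<tau> \<circ> \<sigma>)) =
          of_int (sign (inv \<kappa>)) * column_sign \<omega> (inv (\<tau> \<circ> \<rho>) \<circ> \<sigma>)"
        unfolding 1 2 comp_assoc by (rule column_sign_comp) (simp add: d column_group_inv)
    qed
    also have "(\<Sum>\<tau>\<in>row_group \<omega>. column_sign \<omega> (inv (\<tau> \<circ> \<rho>) \<circ> \<sigma>)) = young_symmetrizer \<omega> \<sigma>"
      unfolding young_symmetrizer_eq
      by (rule sum.reindex_bij_betw[OF bij_betw_comp_right_row_group[OF d(1)]])
    finally show "(\<Sum>\<tau>\<in>row_group \<omega>. column_sign \<omega> (inv g \<circ> (inv \<tau> \<circ> \<sigma>))) =
      of_int (sign (inv \<kappa>)) * young_symmetrizer \<omega> \<sigma>" .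
  qed
qed

lemma young_symmetrizer_closed: "young_symmetrizer \<omega> \<in> group_algebra (sum_list \<omega>)"
  unfolding young_symmetrizer_def
  by (rule galg_mult_closed) (auto simp: group_algebra_def column_group_permutes)

text \<open>With \<open>c = a b\<close>, the square is \<open>a (b a) b\<close>. Expanding
  \<open>d = b a\<close> over the permutations \<open>g\<close> gives a combination of the elements
  \<open>a g b\<close>, each of which is a multiple of \<open>c\<close> by
  \<open>von_neumann\<close>.\<close>

lemma young_symmetrizer_square:
  assumes "sorted_wrt (\<ge>) \<omega>"
  obtains \<alpha> where "galg_mult (sum_list \<omega>) (young_symmetrizer \<omega>) (young_symmetrizer \<omega>) =
    (\<lambda>\<sigma>. \<alpha> * young_symmetrizer \<omega> \<sigma>)"
proof -
  let ?n = "sum_list \<omega>"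
  let ?S = "{g. g permutes {..<?n}}"
  let ?c = "young_symmetrizer \<omega>"
  define a :: "(nat \<Rightarrow> nat) \<Rightarrow> complex" where "a = (\<lambda>\<sigma>. if \<sigma> \<in> row_group \<omega> then 1 else 0)"
  define b where "b = column_sign \<omega>"
  have c: "?c = galg_mult ?n a b"
    unfolding young_symmetrizer_def a_def b_def column_sign_def ..
  obtain s where s: "\<And>g \<sigma>. g \<in> ?S \<Longrightarrow>
      (\<Sum>\<tau>\<in>row_group \<omega>. b (inv g \<circ> (inv \<tau> \<circ> \<sigma>))) = s g * ?c \<sigma>"
    using von_neumann[OF assms] unfolding b_def mem_Collect_eq by metis
  define d where "d = galg_mult ?n b a"
  have "galg_mult ?n ?c ?c \<sigma> = (\<Sum>g\<in>?S. d g * s g) * ?c \<sigma>" for \<sigma>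
  proof -
    have "galg_mult ?n ?c ?c \<sigma> = galg_mult ?n a (galg_mult ?n d b) \<sigma>"
      by (simp add: c d_def galg_mult_assoc)
    also have "\<dots> = (\<Sum>\<tau>\<in>row_group \<omega>. galg_mult ?n d b (inv \<tau> \<circ> \<sigma>))"
      unfolding galg_mult_def[of _ a]
      by (rule sum.mono_neutral_cong_right) (auto simp: row_group_permutes finite_permutations a_def)
    also have "\<dots> = (\<Sum>g\<in>?S. d g * (\<Sum>\<tau>\<in>row_group \<omega>. b (inv g \<circ> (inv \<tau> \<circ> \<sigma>))))"
      unfolding galg_mult_def[of _ d] sum_distrib_left by (rule sum.swap)
    also have "\<dots> = (\<Sum>g\<in>?S. d g * s g) * ?c \<sigma>"
      using s by (simp add: sum_distrib_left sum_distrib_right mult.assoc)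
    finally show ?thesis .
  qed
  then show thesis using that by blast
qed

lemma row_column_group_Int:
  assumes "\<sigma> \<in> row_group \<omega>" "\<sigma> \<in> column_group \<omega>" shows "\<sigma> = id"
proof
  fix x
  show "\<sigma> x = id x"
  proof (cases "x < sum_list \<omega>")
    case True
    with assms row_col_inj[of "\<sigma> x" \<omega> x] show ?thesis
      by (auto simp: row_group_iff column_group_iff permutes_lt)
  next
    case False
    with row_group_permutes[OF assms(1)] show ?thesis by (simp add: permutes_def)
  qed
qed

text \<open>The identity has only the trivial factorisation into a row and a column permutation.
  This value normalizes the trace at the identity.\<close>

lemma young_symmetrizer_id: "young_symmetrizer \<omega> id = 1"
proof -
  have id: "id \<in> row_group \<omega>" "id \<in> column_group \<omega>"
    by (simp_all add: row_group_iff column_group_iff permutes_id)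
  have "young_symmetrizer \<omega> id = (\<Sum>\<tau>\<in>row_group \<omega>. if \<tau> = id then 1 else 0)"
    unfolding young_symmetrizer_eq
  proof (intro sum.cong refl)
    fix \<tau> assume \<tau>: "\<tau> \<in> row_group \<omega>"
    show "column_sign \<omega> (inv \<tau> \<circ> id) = (if \<tau> = id then 1 else 0)"
    proof (cases "inv \<tau> \<in> column_group \<omega>")
      case True
      with row_column_group_Int[OF row_group_inv[OF \<tau>]] have "inv \<tau> = id" by simp
      then have "\<tau> = id"
        using permutes_inv_inv[OF row_group_permutes[OF \<tau>]] by (metis inv_id)
      then show ?thesis using id by (simp add: column_sign_def)
    next
      case False
      then show ?thesis using id by (auto simp: column_sign_def)
    qed
  qed
  also have "\<dots> = 1"
  proof -
    have "finite (row_group \<omega>)"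
      by (rule finite_subset[OF _ finite_permutations[of "{..<sum_list \<omega>}"]]) (auto simp: row_group_permutes)
    with id show ?thesis by simp
  qed
  finally show ?thesis .
qed

text \<open>The trace formula expresses \<open>\<alpha>\<close> times each character as a sum of
  coefficients of the symmetrizer. At the identity every summand is 1, so
  \<open>\<alpha> * irr_character \<omega> id\<close> is the factorial of the size of the shape.
  Hence both factors are nonzero and \<open>\<alpha>\<close> cancels in the quotient.\<close>

lemma irr_character_quotient:
  assumes sorted: "sorted_wrt (\<ge>) \<omega>" and \<pi>: "\<pi> permutes {..<sum_list \<omega>}"
  shows "irr_character \<omega> \<pi> / irr_character \<omega> id =
    (\<Sum>g | g permutes {..<sum_list \<omega>}. young_symmetrizer \<omega> (inv g \<circ> inv \<pi> \<circ> g)) / fact (sum_list \<omega>)"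
proof -
  let ?n = "sum_list \<omega>"
  let ?c = "young_symmetrizer \<omega>"
  obtain \<alpha> where \<alpha>: "galg_mult ?n ?c ?c = (\<lambda>\<sigma>. \<alpha> * ?c \<sigma>)"
    by (rule young_symmetrizer_square[OF sorted])
  have *: "(\<Sum>g | g permutes {..<?n}. ?c (inv g \<circ> inv \<pi> \<circ> g)) = \<alpha> * irr_character \<omega> \<pi>"
    if "\<pi> permutes {..<?n}" for \<pi>
    unfolding irr_character_def specht_module_def
    by (rule trace_left_ideal[OF young_symmetrizer_closed \<alpha> that])
  have "(\<Sum>g | g permutes {..<?n}. ?c (inv g \<circ> inv id \<circ> g)) = (\<Sum>g | g permutes {..<?n}. 1)"
    by (intro sum.cong refl) (auto simp: permutes_inv_o young_symmetrizer_id)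
  then have f: "\<alpha> * irr_character \<omega> id = fact ?n"
    using *[OF permutes_id] by (simp add: card_permutations)
  have "fact ?n \<noteq> (0::complex)" by simp
  then have "\<alpha> \<noteq> 0" "irr_character \<omega> id \<noteq> 0" using f by (metis mult_zero_left, metis mult_zero_right)
  then show ?thesis unfolding *[OF \<pi>] f[symmetric] by simp
qed

section \<open>Characters as sums over factorisations\<close>

lemma conj_permutes:
  "g permutes S \<Longrightarrow> \<sigma> permutes S \<Longrightarrow> (inv g \<circ> \<sigma> \<circ> g) permutes S"
  by (simp add: permutes_compose permutes_inv)

lemma sign_conj:
  assumes "g permutes S" "\<sigma> permutes S" "finite S"
  shows "sign (inv g \<circ> \<sigma> \<circ> g) = sign \<sigma>"
proof -
  have p: "permutation g" "permutation \<sigma>" using assms by (auto simp: permutation_permutes)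
  then have "sign (inv g \<circ> \<sigma> \<circ> g) = sign g * (sign g * sign \<sigma>)"
    by (simp add: sign_compose permutation_compose permutation_inverse sign_inverse)
  then show ?thesis by simp
qed

lemma bij_betw_conj_permutes:
  assumes "g permutes S"
  shows "bij_betw (\<lambda>\<rho>. inv g \<circ> \<rho> \<circ> g) {\<tau>. \<tau> permutes S} {\<tau>. \<tau> permutes S}"
proof -
  have "bij_betw ((\<lambda>\<rho>. inv g \<circ> \<rho>) \<circ> (\<lambda>\<rho>. \<rho> \<circ> g)) {\<tau>. \<tau> permutes S} {\<tau>. \<tau> permutes S}"
    by (rule bij_betw_trans[OF bij_betw_comp_right_permutes[OF assms]
          bij_betw_comp_left_permutes[OF permutes_inv[OF assms]]])
  moreover have "(\<lambda>\<rho>. inv g \<circ> \<rho>) \<circ> (\<lambda>\<rho>. \<rho> \<circ> g) = (\<lambda>\<rho>. inv g \<circ> \<rho> \<circ> g)"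
    by (auto simp: fun_eq_iff)
  ultimately show ?thesis by simp
qed

text \<open>Letters from \<open>k\<close> on are fixed by \<open>\<sigma>\<close> and impose no
  condition. What remains is a condition on where \<open>inv g\<close> places the first
  \<open>k\<close> letters.\<close>

lemma conj_invariant_iff:
  fixes f :: "nat \<Rightarrow> 'b"
  assumes g: "g permutes {..<n}" and \<sigma>: "\<sigma> permutes {..<k}" and k: "k \<le> n"
  shows "(\<forall>x<n. f ((inv g \<circ> \<sigma> \<circ> g) x) = f x) \<longleftrightarrow> (\<forall>x<k. f (inv g (\<sigma> x)) = f (inv g x))"
proof
  assume *: "\<forall>x<n. f ((inv g \<circ> \<sigma> \<circ> g) x) = f x"
  show "\<forall>x<k. f (inv g (\<sigma> x)) = f (inv g x)"
  proof (intro allI impI)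
    fix x assume "x < k"
    then have "inv g x < n" using k permutes_inv[OF g] by (simp add: permutes_lt)
    with * permutes_inverses(1)[OF g, of x] show "f (inv g (\<sigma> x)) = f (inv g x)"
      by (metis comp_apply)
  qed
next
  assume *: "\<forall>x<k. f (inv g (\<sigma> x)) = f (inv g x)"
  have "f (inv g (\<sigma> x)) = f (inv g x)" for x
    using * \<sigma> by (cases "x < k") (auto simp: permutes_def)
  then show "\<forall>x<n. f ((inv g \<circ> \<sigma> \<circ> g) x) = f x"
    by (simp add: permutes_inverses(2)[OF g])
qed

text \<open>Boxes fixed by a product of a row and a column permutation are fixed by both factors,
  since they are determined by their row and column.\<close>

lemma row_column_factor_permutes:
  assumes k: "k \<le> sum_list \<omega>" and \<pi>: "\<pi> permutes {..<k}"
    and g: "g permutes {..<sum_list \<omega>}" and \<rho>: "\<rho> permutes {..<sum_list \<omega>}"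
    and R: "inv g \<circ> \<rho> \<circ> g \<in> row_group \<omega>"
    and C: "inv g \<circ> (inv \<rho> \<circ> inv \<pi>) \<circ> g \<in> column_group \<omega>"
  shows "\<rho> permutes {..<k}"
proof (rule permutes_superset[OF \<rho>])
  fix x assume x: "x \<in> {..<sum_list \<omega>} - {..<k}"
  define \<tau> where "\<tau> = inv g \<circ> \<rho> \<circ> g"
  define \<kappa> where "\<kappa> = inv g \<circ> (inv \<rho> \<circ> inv \<pi>) \<circ> g"
  define y where "y = inv g x"
  have y: "y < sum_list \<omega>" using x permutes_inv[OF g] by (simp add: y_def permutes_lt)
  have gy: "g y = x" by (simp add: y_def permutes_inverses(1)[OF g])
  have "inv \<pi> x = x" using x permutes_inv[OF \<pi>] by (simp add: permutes_def)
  \<comment> \<open>Since \<open>\<pi>\<close> fixes \<open>x\<close>, the row permutation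
    \<open>\<tau>\<close> brings \<open>\<kappa> y\<close> back to \<open>y\<close>. So
    \<open>\<kappa> y\<close> and \<open>y\<close> share their row, by \<open>\<tau>\<close>, and
    their column, by \<open>\<kappa>\<close>.\<close>
  then have \<kappa>y: "\<tau> (\<kappa> y) = y"
    by (simp add: \<tau>_def \<kappa>_def gy permutes_inverses(1)[OF g] permutes_inverses(1)[OF \<rho>]) (simp add: y_def)
  have \<kappa>n: "\<kappa> y < sum_list \<omega>" using C y by (simp add: \<kappa>_def[symmetric] column_group_iff permutes_lt)
  have "row \<omega> (\<kappa> y) = row \<omega> y" using R \<kappa>n \<kappa>y by (metis row_group_iff \<tau>_def)
  moreover have "col \<omega> (\<kappa> y) = col \<omega> y" using C y by (simp add: \<kappa>_def[symmetric] column_group_iff)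
  ultimately have "\<kappa> y = y" using row_col_inj \<kappa>n y by blast
  with \<kappa>y have "inv g (\<rho> x) = y" by (simp add: \<tau>_def gy)
  then show "\<rho> x = x" by (metis gy g permutes_inverses(1))
qed

text \<open>The map \<open>u\<close> places the first \<open>k\<close> letters on entries of the
  tableau. Injectivity is kept out of this notion, so that the number of such maps factorises over
  cycles later.\<close>

definition compatible :: "nat list \<Rightarrow> nat \<Rightarrow> (nat \<Rightarrow> nat) \<Rightarrow> (nat \<Rightarrow> nat) \<Rightarrow> (nat \<Rightarrow> nat) \<Rightarrow> bool" where
  "compatible \<omega> k \<rho> \<sigma> u \<longleftrightarrow>
    (\<forall>x<k. row \<omega> (u (\<rho> x)) = row \<omega> (u x)) \<and> (\<forall>x<k. col \<omega> (u (\<sigma> x)) = col \<omega> (u x))"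

text \<open>Writing the row permutation as the conjugate of \<open>\<rho>\<close> by
  \<open>g\<close> turns the column factor into the conjugate of
  \<open>inv \<rho> \<circ> inv \<pi>\<close>. Both memberships become conditions on the placement
  \<open>inv g\<close>, conjugation preserves the sign, and only those \<open>\<rho>\<close> that
  permute the first \<open>k\<close> letters contribute.\<close>

lemma young_symmetrizer_conj:
  assumes k: "k \<le> sum_list \<omega>" and \<pi>: "\<pi> permutes {..<k}"
    and g: "g permutes {..<sum_list \<omega>}"
  shows "young_symmetrizer \<omega> (inv g \<circ> inv \<pi> \<circ> g) =
    (\<Sum>\<rho> | \<rho> permutes {..<k}. if compatible \<omega> k \<rho> (inv \<rho> \<circ> inv \<pi>) (inv g)
       then of_int (sign (inv \<rho> \<circ> inv \<pi>)) else 0)"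
proof -
  let ?n = "sum_list \<omega>"
  define F :: "(nat \<Rightarrow> nat) \<Rightarrow> complex" where
    "F \<rho> = (if inv g \<circ> \<rho> \<circ> g \<in> row_group \<omega> then column_sign \<omega> (inv g \<circ> (inv \<rho> \<circ> inv \<pi>) \<circ> g) else 0)" for \<rho>
  have \<pi>n: "\<pi> permutes {..<?n}" using \<pi> k by (auto intro: permutes_subset)
  have "young_symmetrizer \<omega> (inv g \<circ> inv \<pi> \<circ> g) =
    (\<Sum>\<tau> | \<tau> permutes {..<?n}. if \<tau> \<in> row_group \<omega>
       then column_sign \<omega> (inv \<tau> \<circ> (inv g \<circ> inv \<pi> \<circ> g)) else 0)"
    unfolding young_symmetrizer_eq
    by (rule sum.mono_neutral_cong_left) (auto simp: row_group_permutes finite_permutations)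
  also have "\<dots> = (\<Sum>\<rho> | \<rho> permutes {..<?n}. if inv g \<circ> \<rho> \<circ> g \<in> row_group \<omega>
       then column_sign \<omega> (inv (inv g \<circ> \<rho> \<circ> g) \<circ> (inv g \<circ> inv \<pi> \<circ> g)) else 0)"
    by (rule sum.reindex_bij_betw[OF bij_betw_conj_permutes[OF g], symmetric])
  also have "\<dots> = (\<Sum>\<rho> | \<rho> permutes {..<?n}. F \<rho>)"
  proof (intro sum.cong refl)
    fix \<rho> assume "\<rho> \<in> {\<rho>. \<rho> permutes {..<?n}}"
    then have \<rho>: "\<rho> permutes {..<?n}" by simp
    have "inv (inv g \<circ> \<rho> \<circ> g) = inv g \<circ> inv \<rho> \<circ> g"
      using inv_comp_permutes[OF permutes_inv[OF g] permutes_compose[OF g \<rho>]]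
        inv_comp_permutes[OF \<rho> g] permutes_inv_inv[OF g] by (simp add: comp_assoc)
    then have "inv (inv g \<circ> \<rho> \<circ> g) \<circ> (inv g \<circ> inv \<pi> \<circ> g) = inv g \<circ> (inv \<rho> \<circ> inv \<pi>) \<circ> g"
      by (simp add: fun_eq_iff permutes_inverses(1)[OF g])
    then show "(if inv g \<circ> \<rho> \<circ> g \<in> row_group \<omega>
       then column_sign \<omega> (inv (inv g \<circ> \<rho> \<circ> g) \<circ> (inv g \<circ> inv \<pi> \<circ> g)) else 0) = F \<rho>"
      by (simp only: F_def)
  qed
  also have "\<dots> = (\<Sum>\<rho> | \<rho> permutes {..<k}. F \<rho>)"
  proof (rule sum.mono_neutral_right)
    show "{\<rho>. \<rho> permutes {..<k}} \<subseteq> {\<rho>. \<rho> permutes {..<?n}}"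
      using k by (auto intro: permutes_subset)
    show "\<forall>\<rho>\<in>{\<rho>. \<rho> permutes {..<?n}} - {\<rho>. \<rho> permutes {..<k}}. F \<rho> = 0"
      using row_column_factor_permutes[OF k \<pi> g] by (auto simp: F_def column_sign_def)
  qed (simp add: finite_permutations)
  also have "\<dots> = (\<Sum>\<rho> | \<rho> permutes {..<k}. if compatible \<omega> k \<rho> (inv \<rho> \<circ> inv \<pi>) (inv g)
       then of_int (sign (inv \<rho> \<circ> inv \<pi>)) else 0)"
  proof (intro sum.cong refl)
    fix \<rho> assume "\<rho> \<in> {\<rho>. \<rho> permutes {..<k}}"
    then have \<rho>: "\<rho> permutes {..<k}" by simp
    then have \<rho>n: "\<rho> permutes {..<?n}" using k by (auto intro: permutes_subset)
    have \<sigma>: "(inv \<rho> \<circ> inv \<pi>) permutes {..<k}" using \<rho> \<pi> by (simp add: permutes_compose permutes_inv)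
    have \<sigma>n: "(inv \<rho> \<circ> inv \<pi>) permutes {..<?n}" using \<rho>n \<pi>n by (simp add: permutes_compose permutes_inv)
    have "inv g \<circ> \<rho> \<circ> g \<in> row_group \<omega> \<longleftrightarrow> (\<forall>x<k. row \<omega> (inv g (\<rho> x)) = row \<omega> (inv g x))"
      unfolding row_group_iff conj_invariant_iff[OF g \<rho> k, where f = "\<lambda>x. row \<omega> x"]
      using conj_permutes[OF g \<rho>n] by simp
    moreover have "inv g \<circ> (inv \<rho> \<circ> inv \<pi>) \<circ> g \<in> column_group \<omega> \<longleftrightarrow>
      (\<forall>x<k. col \<omega> (inv g ((inv \<rho> \<circ> inv \<pi>) x)) = col \<omega> (inv g x))"
      unfolding column_group_iff conj_invariant_iff[OF g \<sigma> k, where f = "\<lambda>x. col \<omega> x"]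
      using conj_permutes[OF g \<sigma>n] by simp
    ultimately show "F \<rho> = (if compatible \<omega> k \<rho> (inv \<rho> \<circ> inv \<pi>) (inv g)
       then of_int (sign (inv \<rho> \<circ> inv \<pi>)) else 0)"
      unfolding F_def column_sign_def compatible_def sign_conj[OF g \<sigma>n finite_lessThan] by simp
  qed
  finally show ?thesis .
qed

section \<open>Injective placements as restrictions of permutations\<close>

lemma inj_extends_to_permutation:
  fixes u :: "nat \<Rightarrow> nat"
  assumes u: "u \<in> {..<k} \<rightarrow> {..<n}" "inj_on u {..<k}" and k: "k \<le> n"
  obtains g where "g permutes {..<n}" "\<And>x. x < k \<Longrightarrow> g x = u x"
proof -
  have "card ({..<n} - u ` {..<k}) = card {k..<n}"
    using u k by (subst card_Diff_subset) (auto simp: card_image)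
  then obtain v where v: "bij_betw v {k..<n} ({..<n} - u ` {..<k})"
    by (metis finite_same_card_bij finite_atLeastLessThan finite_Diff finite_lessThan)
  define g where "g x = (if x < k then u x else if x < n then v x else x)" for x
  have "bij_betw g ({..<k} \<union> {k..<n}) (u ` {..<k} \<union> ({..<n} - u ` {..<k}))"
  proof (rule bij_betw_combine)
    show "bij_betw g {..<k} (u ` {..<k})"
      using u(2) by (auto simp: bij_betw_def inj_on_def g_def)
    show "bij_betw g {k..<n} ({..<n} - u ` {..<k})"
      using v by (rule bij_betw_cong[THEN iffD1, rotated]) (auto simp: g_def)
  qed auto
  moreover have "{..<k} \<union> {k..<n} = {..<n}" "u ` {..<k} \<union> ({..<n} - u ` {..<k}) = {..<n}"
    using u(1) k by auto
  ultimately have "g permutes {..<n}"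
    by (intro bij_imp_permutes) (use k in \<open>auto simp: g_def\<close>)
  with that show thesis by (auto simp: g_def)
qed

text \<open>Relative to one extension \<open>h\<close>, every other extension is
  \<open>h \<circ> \<tau>\<close> for a unique permutation \<open>\<tau>\<close> of the letters from
  \<open>k\<close> on.\<close>

lemma card_extensions_permutes:
  assumes u: "u \<in> {..<k} \<rightarrow>\<^sub>E {..<n}" "inj_on u {..<k}" and k: "k \<le> n"
  shows "card {g. g permutes {..<n} \<and> restrict g {..<k} = u} = fact (n - k)"
proof -
  obtain h where h: "h permutes {..<n}" "\<And>x. x < k \<Longrightarrow> h x = u x"
    using inj_extends_to_permutation[OF _ u(2) k] u(1) by auto
  have "bij_betw (\<lambda>\<tau>. h \<circ> \<tau>) {\<tau>. \<tau> permutes {k..<n}} {g. g permutes {..<n} \<and> restrict g {..<k} = u}"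
  proof (rule bij_betwI[where g = "\<lambda>g. inv h \<circ> g"])
    show "(\<lambda>\<tau>. h \<circ> \<tau>) \<in> {\<tau>. \<tau> permutes {k..<n}} \<rightarrow> {g. g permutes {..<n} \<and> restrict g {..<k} = u}"
    proof (safe intro!: permutes_compose h(1))
      fix \<tau> assume \<tau>: "\<tau> permutes {k..<n}"
      show "\<tau> permutes {..<n}" using \<tau> by (rule permutes_subset) auto
      show "restrict (h \<circ> \<tau>) {..<k} = u"
        using \<tau> u(1) h(2) by (auto simp: fun_eq_iff restrict_def permutes_def PiE_def extensional_def)
    qed
    show "(\<lambda>g. inv h \<circ> g) \<in> {g. g permutes {..<n} \<and> restrict g {..<k} = u} \<rightarrow> {\<tau>. \<tau> permutes {k..<n}}"
    proof (intro Pi_I CollectI)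
      fix g assume "g \<in> {g. g permutes {..<n} \<and> restrict g {..<k} = u}"
      then have g: "g permutes {..<n}" "restrict g {..<k} = u" by auto
      show "(inv h \<circ> g) permutes {k..<n}"
      proof (rule permutes_superset)
        show "(inv h \<circ> g) permutes {..<n}" using g h by (simp add: permutes_compose permutes_inv)
        fix x assume "x \<in> {..<n} - {k..<n}"
        then have "x < k" by auto
        with g(2) h(2)[of x] have "g x = h x" by auto
        then show "(inv h \<circ> g) x = x" by (simp add: permutes_inverses(2)[OF h(1)])
      qed
    qed
  qed (auto simp: comp_assoc[symmetric] permutes_inv_o[OF h(1)])
  then have "card {g. g permutes {..<n} \<and> restrict g {..<k} = u} = card {\<tau>. \<tau> permutes {k..<n}}"
    by (rule bij_betw_same_card[symmetric])
  then show ?thesis by (simp add: card_permutations)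
qed

lemma card_permutes_restrict:
  assumes k: "k \<le> n"
  shows "card {g. g permutes {..<n} \<and> Pr (restrict g {..<k})} =
    fact (n - k) * card {u \<in> {..<k} \<rightarrow>\<^sub>E {..<n}. inj_on u {..<k} \<and> Pr u}"
proof -
  let ?U = "{u \<in> {..<k} \<rightarrow>\<^sub>E {..<n}. inj_on u {..<k} \<and> Pr u}"
  let ?E = "\<lambda>u. {g. g permutes {..<n} \<and> restrict g {..<k} = u}"
  have eq: "{g. g permutes {..<n} \<and> Pr (restrict g {..<k})} = (\<Union>u\<in>?U. ?E u)"
  proof safe
    fix g assume g: "g permutes {..<n}" "Pr (restrict g {..<k})"
    have "inj_on (restrict g {..<k}) {..<k}"
      using permutes_inj[OF g(1)] by (auto simp: inj_on_def inj_def)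
    moreover have "restrict g {..<k} \<in> {..<k} \<rightarrow>\<^sub>E {..<n}"
      using g(1) k by (auto simp: permutes_lt)
    ultimately show "g \<in> (\<Union>u\<in>?U. ?E u)" using g by auto
  qed
  have "card (\<Union>u\<in>?U. ?E u) = (\<Sum>u\<in>?U. card (?E u))"
  proof (rule card_UN_disjoint)
    show "finite ?U" by (simp add: finite_PiE)
    show "\<forall>u\<in>?U. finite (?E u)"
      by (auto intro: finite_subset[OF _ finite_permutations[of "{..<n}"]])
    show "\<forall>u\<in>?U. \<forall>u'\<in>?U. u \<noteq> u' \<longrightarrow> ?E u \<inter> ?E u' = {}" by blast
  qed
  also have "\<dots> = (\<Sum>u\<in>?U. fact (n - k))"
    by (intro sum.cong refl card_extensions_permutes k) auto
  finally show ?thesis unfolding eq by simp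
qed

lemma compatible_restrict:
  assumes "\<rho> permutes {..<k}" "\<sigma> permutes {..<k}"
  shows "compatible \<omega> k \<rho> \<sigma> (restrict u {..<k}) \<longleftrightarrow> compatible \<omega> k \<rho> \<sigma> u"
  using assms by (simp add: compatible_def permutes_lt)

text \<open>Exchanging two points with the same image under \<open>u\<close> is a sign-reversing involution.\<close>

lemma sum_compatible_not_inj:
  assumes \<pi>: "\<pi> permutes {..<k}" and u: "\<not> inj_on u {..<k}"
  shows "(\<Sum>\<rho> | \<rho> permutes {..<k}. if compatible \<omega> k \<rho> (inv \<rho> \<circ> inv \<pi>) u
       then of_int (sign (inv \<rho> \<circ> inv \<pi>)) else 0) = (0::complex)" (is "sum ?F _ = 0")
proof -
  obtain i j where ij: "i < k" "j < k" "i \<noteq> j" "u i = u j" using u by (auto simp: inj_on_def)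
  define t where "t = transpose i j"
  have t: "t permutes {..<k}" using ij by (auto simp: t_def intro!: permutes_swap_id)
  have ut: "u (t x) = u x" for x using ij by (auto simp: t_def transpose_def)
  have inv_t: "inv t = t" by (simp add: t_def)
  have "sum ?F {\<rho>. \<rho> permutes {..<k}} = (\<Sum>\<rho> | \<rho> permutes {..<k}. ?F (\<rho> \<circ> t))"
    by (rule sum.reindex_bij_betw[OF bij_betw_comp_right_permutes[OF t], symmetric])
  also have "\<dots> = (\<Sum>\<rho> | \<rho> permutes {..<k}. - ?F \<rho>)"
  proof (intro sum.cong refl)
    fix \<rho> assume "\<rho> \<in> {\<rho>. \<rho> permutes {..<k}}"
    then have \<rho>: "\<rho> permutes {..<k}" by simp
    \<comment> \<open>Passing from \<open>\<rho>\<close> to \<open>\<rho> \<circ> t\<close>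
      multiplies the other factor of the factorisation by \<open>t\<close>, which reverses its sign.
      Compatibility is unchanged, as \<open>u\<close> does not distinguish \<open>i\<close> from
      \<open>j\<close>.\<close>
    have inv: "inv (\<rho> \<circ> t) \<circ> inv \<pi> = t \<circ> (inv \<rho> \<circ> inv \<pi>)"
      using \<rho> t by (simp add: inv_comp_permutes inv_t comp_assoc)
    have "(\<forall>x<k. row \<omega> (u ((\<rho> \<circ> t) x)) = row \<omega> (u x)) \<longleftrightarrow> (\<forall>x<k. row \<omega> (u (\<rho> x)) = row \<omega> (u x))"
      by (metis comp_apply permutes_inverses(1) permutes_lt t inv_t ut)
    then have c: "compatible \<omega> k (\<rho> \<circ> t) (inv (\<rho> \<circ> t) \<circ> inv \<pi>) u \<longleftrightarrow> compatible \<omega> k \<rho> (inv \<rho> \<circ> inv \<pi>) u"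
      unfolding inv compatible_def by (simp add: ut)
    have "(inv \<rho> \<circ> inv \<pi>) permutes {..<k}" using \<rho> \<pi> by (simp add: permutes_compose permutes_inv)
    then have "sign (t \<circ> (inv \<rho> \<circ> inv \<pi>)) = sign t * sign (inv \<rho> \<circ> inv \<pi>)"
      using t finite_lessThan by (intro sign_compose) (auto simp: permutation_permutes)
    then have s: "sign (inv (\<rho> \<circ> t) \<circ> inv \<pi>) = - sign (inv \<rho> \<circ> inv \<pi>)"
      unfolding inv using ij by (simp add: t_def sign_swap_id)
    show "?F (\<rho> \<circ> t) = - ?F \<rho>" unfolding c s by simp
  qed
  finally have "sum ?F {\<rho>. \<rho> permutes {..<k}} = - sum ?F {\<rho>. \<rho> permutes {..<k}}"
    by (simp add: sum_negf)
  then show ?thesis by simp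
qed

lemma prod_falling_fact:
  assumes "k \<le> n"
  shows "(\<Prod>i<k. of_nat n - of_nat i) * fact (n - k) = (fact n :: complex)"
  using assms
proof (induction k)
  case (Suc k)
  then have "fact (n - k) = (of_nat n - of_nat k) * (fact (n - Suc k) :: complex)"
    by (simp add: fact_reduce of_nat_diff)
  with Suc show ?case by (simp add: mult.assoc)
qed simp

text \<open>In the average over \<open>g\<close>, each injective placement of the \<open>k\<close>
  letters arises from \<open>fact (?n - k)\<close> permutations. Together with the falling factorial
  of the normalization this cancels \<open>fact ?n\<close>. Noninjective placements may then be
  added freely, because their signed contributions sum to zero over \<open>\<rho>\<close>.\<close>

lemma character_eq_sum_factorisations:
  assumes sorted: "sorted_wrt (\<ge>) \<omega>" and k: "k \<le> sum_list \<omega>" and \<pi>: "\<pi> permutes {..<k}"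
  shows "(\<Prod>i<k. of_nat (sum_list \<omega>) - of_nat i) * irr_character \<omega> \<pi> / irr_character \<omega> id =
    (\<Sum>\<rho> | \<rho> permutes {..<k}. of_int (sign (inv \<rho> \<circ> inv \<pi>)) *
      of_nat (card {u \<in> {..<k} \<rightarrow>\<^sub>E {..<sum_list \<omega>}. compatible \<omega> k \<rho> (inv \<rho> \<circ> inv \<pi>) u}))"
proof -
  let ?n = "sum_list \<omega>"
  let ?S = "{\<rho>. \<rho> permutes {..<k}}" and ?G = "{g. g permutes {..<?n}}" and ?E = "{..<k} \<rightarrow>\<^sub>E {..<?n}"
  define F :: "(nat \<Rightarrow> nat) \<Rightarrow> (nat \<Rightarrow> nat) \<Rightarrow> complex" where
    "F \<rho> u = (if compatible \<omega> k \<rho> (inv \<rho> \<circ> inv \<pi>) u then of_int (sign (inv \<rho> \<circ> inv \<pi>)) else 0)" for \<rho> u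
  have finE: "finite ?E" by (simp add: finite_PiE)
  have F: "(\<Sum>u\<in>A. F \<rho> u) = of_int (sign (inv \<rho> \<circ> inv \<pi>)) * of_nat (card {u \<in> A. compatible \<omega> k \<rho> (inv \<rho> \<circ> inv \<pi>) u})"
    if "finite A" for A \<rho>
    using that by (simp add: F_def sum.If_cases Int_def)
  have \<pi>n: "\<pi> permutes {..<?n}" using \<pi> k by (auto intro: permutes_subset)
  have "(\<Sum>g\<in>?G. young_symmetrizer \<omega> (inv g \<circ> inv \<pi> \<circ> g)) = (\<Sum>g\<in>?G. \<Sum>\<rho>\<in>?S. F \<rho> (inv g))"
    unfolding F_def by (intro sum.cong refl young_symmetrizer_conj k \<pi>) auto
  also have "\<dots> = (\<Sum>g\<in>?G. \<Sum>\<rho>\<in>?S. F \<rho> g)"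
    by (rule sum.reindex_bij_betw[OF bij_betw_inv_permutes, where g = "\<lambda>g. \<Sum>\<rho>\<in>?S. F \<rho> g"])
  also have "\<dots> = (\<Sum>\<rho>\<in>?S. \<Sum>g\<in>?G. F \<rho> g)" by (rule sum.swap)
  also have "\<dots> = (\<Sum>\<rho>\<in>?S. fact (?n - k) * (\<Sum>u | u \<in> ?E \<and> inj_on u {..<k}. F \<rho> u))"
  proof (intro sum.cong refl)
    fix \<rho> assume "\<rho> \<in> ?S"
    then have \<rho>: "\<rho> permutes {..<k}" by simp
    then have \<sigma>: "(inv \<rho> \<circ> inv \<pi>) permutes {..<k}" using \<pi> by (simp add: permutes_compose permutes_inv)
    have fin: "finite ?G" "finite {u. u \<in> ?E \<and> inj_on u {..<k}}"
      using finE by (auto simp: finite_permutations)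
    show "(\<Sum>g\<in>?G. F \<rho> g) = fact (?n - k) * (\<Sum>u | u \<in> ?E \<and> inj_on u {..<k}. F \<rho> u)"
      unfolding F[OF fin(1)] F[OF fin(2)]
      using card_permutes_restrict[OF k, of "compatible \<omega> k \<rho> (inv \<rho> \<circ> inv \<pi>)"]
      by (simp add: compatible_restrict[OF \<rho> \<sigma>] conj_assoc)
  qed
  also have "\<dots> = fact (?n - k) * (\<Sum>\<rho>\<in>?S. \<Sum>u | u \<in> ?E \<and> inj_on u {..<k}. F \<rho> u)"
    by (simp add: sum_distrib_left)
  also have "(\<Sum>\<rho>\<in>?S. \<Sum>u | u \<in> ?E \<and> inj_on u {..<k}. F \<rho> u) = (\<Sum>\<rho>\<in>?S. \<Sum>u\<in>?E. F \<rho> u)"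
  proof (subst sum.swap, subst (2) sum.swap, rule sum.mono_neutral_left)
    show "\<forall>u\<in>?E - {u. u \<in> ?E \<and> inj_on u {..<k}}. (\<Sum>\<rho>\<in>?S. F \<rho> u) = 0"
      unfolding F_def by (intro ballI sum_compatible_not_inj \<pi>) auto
  qed (use finE in auto)
  finally have *: "(\<Sum>g\<in>?G. young_symmetrizer \<omega> (inv g \<circ> inv \<pi> \<circ> g)) = fact (?n - k) * (\<Sum>\<rho>\<in>?S. \<Sum>u\<in>?E. F \<rho> u)" .
  have "(\<Prod>i<k. of_nat ?n - of_nat i) * irr_character \<omega> \<pi> / irr_character \<omega> id =
    (\<Prod>i<k. of_nat ?n - of_nat i) * fact (?n - k) * (\<Sum>\<rho>\<in>?S. \<Sum>u\<in>?E. F \<rho> u) / fact ?n"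
    unfolding times_divide_eq_right[symmetric] irr_character_quotient[OF sorted \<pi>n] * by simp
  also have "\<dots> = (\<Sum>\<rho>\<in>?S. \<Sum>u\<in>?E. F \<rho> u)"
    unfolding prod_falling_fact[OF k] by simp
  finally show ?thesis unfolding F[OF finE] .
qed

section \<open>Orbits of permutations\<close>

definition orbits :: "('a \<Rightarrow> 'a) \<Rightarrow> 'a set \<Rightarrow> 'a set set" where
  "orbits \<sigma> S = orbit \<sigma> ` S"

lemma self_in_orbit:
  assumes "\<sigma> permutes S" "finite S" shows "x \<in> orbit \<sigma> x"
  using assms by (intro permutation_self_in_orbit) (auto simp: permutation_permutes)

lemma orbit_eq:
  assumes "\<sigma> permutes S" "finite S" "y \<in> orbit \<sigma> x" shows "orbit \<sigma> y = orbit \<sigma> x"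
  using assms(3) self_in_orbit[OF assms(1,2), of x] orbit_swap orbit_trans by (metis subsetI subset_antisym)

lemma invariant_on_orbit:
  assumes \<sigma>: "\<sigma> permutes S" and x: "x \<in> S" and y: "y \<in> orbit \<sigma> x"
    and inv: "\<And>x. x \<in> S \<Longrightarrow> e (\<sigma> x) = e x"
  shows "e y = e x"
  using y
proof induction
  case base
  show ?case using inv x .
next
  case (step y)
  then have "y \<in> S" using permutes_orbit_subset[OF \<sigma> x] by blast
  with inv step.IH show ?case by simp
qed

text \<open>An invariant function is constant on each orbit, and its values on different orbits are
  independent. The value on an orbit must be allowed at all of its points, hence the
  intersections.\<close>

lemma card_invariant_functions:
  assumes \<sigma>: "\<sigma> permutes S" and S: "finite S"
  shows "card {e \<in> Pi\<^sub>E S A. \<forall>x\<in>S. e (\<sigma> x) = e x} = (\<Prod>X\<in>orbits \<sigma> S. card (\<Inter>x\<in>X. A x))"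
proof -
  let ?h = "\<lambda>h. \<lambda>x\<in>S. h (orbit \<sigma> x)"
  note self = self_in_orbit[OF \<sigma> S] and orb = permutes_orbit_subset[OF \<sigma>]
  have \<sigma>S: "\<sigma> x \<in> S" if "x \<in> S" for x using that \<sigma> by (simp add: permutes_in_image)
  have \<sigma>orb: "orbit \<sigma> (\<sigma> x) = orbit \<sigma> x" for x by (rule orbit_eq[OF \<sigma> S orbit.base])
  have "bij_betw ?h (\<Pi>\<^sub>E X\<in>orbits \<sigma> S. \<Inter>x\<in>X. A x) {e \<in> Pi\<^sub>E S A. \<forall>x\<in>S. e (\<sigma> x) = e x}"
  proof (rule bij_betwI[where g = "\<lambda>e. \<lambda>X\<in>orbits \<sigma> S. e (SOME x. x \<in> X)"])
    show "?h \<in> (\<Pi>\<^sub>E X\<in>orbits \<sigma> S. \<Inter>x\<in>X. A x) \<rightarrow> {e \<in> Pi\<^sub>E S A. \<forall>x\<in>S. e (\<sigma> x) = e x}"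
    proof (rule Pi_I)
      fix h assume h: "h \<in> (\<Pi>\<^sub>E X\<in>orbits \<sigma> S. \<Inter>x\<in>X. A x)"
      have "h (orbit \<sigma> x) \<in> A x" if "x \<in> S" for x
      proof -
        have "orbit \<sigma> x \<in> orbits \<sigma> S" using that by (simp add: orbits_def)
        from PiE_mem[OF h this] self[of x] show ?thesis by blast
      qed
      then show "?h h \<in> {e \<in> Pi\<^sub>E S A. \<forall>x\<in>S. e (\<sigma> x) = e x}"
        using \<sigma>S by (auto simp: \<sigma>orb)
    qed
    \<comment> \<open>The inverse map evaluates at a representative chosen by \<open>SOME\<close>.
      Invariance makes the result independent of that choice.\<close>
    have e_some: "e (SOME y. y \<in> orbit \<sigma> x) = e x"
      if "\<forall>x\<in>S. e (\<sigma> x) = e x" "x \<in> S" for e :: "'a \<Rightarrow> 'b" and x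
    proof (rule invariant_on_orbit[OF \<sigma> that(2)])
      show "(SOME y. y \<in> orbit \<sigma> x) \<in> orbit \<sigma> x" by (rule someI[of "\<lambda>y. y \<in> orbit \<sigma> x", OF self])
    qed (use that(1) in blast)
    show "(\<lambda>e. \<lambda>X\<in>orbits \<sigma> S. e (SOME x. x \<in> X)) \<in>
      {e \<in> Pi\<^sub>E S A. \<forall>x\<in>S. e (\<sigma> x) = e x} \<rightarrow> (\<Pi>\<^sub>E X\<in>orbits \<sigma> S. \<Inter>x\<in>X. A x)"
    proof (rule Pi_I, rule PiE_I)
      fix e X assume e: "e \<in> {e \<in> Pi\<^sub>E S A. \<forall>x\<in>S. e (\<sigma> x) = e x}" and X: "X \<in> orbits \<sigma> S"
      then obtain x where x: "x \<in> S" "X = orbit \<sigma> x" by (auto simp: orbits_def)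
      have "e (SOME x. x \<in> X) \<in> A y" if "y \<in> X" for y
      proof -
        have y: "y \<in> S" "X = orbit \<sigma> y" using that x orb orbit_eq[OF \<sigma> S] by auto
        with e_some[of e y] e show ?thesis by auto
      qed
      then show "(\<lambda>X\<in>orbits \<sigma> S. e (SOME x. x \<in> X)) X \<in> (\<Inter>x\<in>X. A x)" using X by simp
    qed simp
    show "(\<lambda>X\<in>orbits \<sigma> S. ?h h (SOME x. x \<in> X)) = h" if "h \<in> (\<Pi>\<^sub>E X\<in>orbits \<sigma> S. \<Inter>x\<in>X. A x)" for h
    proof (rule extensionalityI[of _ "orbits \<sigma> S"])
      show "h \<in> extensional (orbits \<sigma> S)" using that by (simp add: PiE_def)
      fix X assume X: "X \<in> orbits \<sigma> S"
      then obtain x where x: "x \<in> S" "X = orbit \<sigma> x" by (auto simp: orbits_def)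
      have "(SOME x. x \<in> X) \<in> orbit \<sigma> x" unfolding x(2) by (rule someI[of "\<lambda>y. y \<in> orbit \<sigma> x", OF self])
      then have "(SOME x. x \<in> X) \<in> S" "orbit \<sigma> (SOME x. x \<in> X) = X"
        using orb[OF x(1)] orbit_eq[OF \<sigma> S] x(2) by auto
      with X show "(\<lambda>X\<in>orbits \<sigma> S. ?h h (SOME x. x \<in> X)) X = h X" by simp
    qed simp
    show "?h (\<lambda>X\<in>orbits \<sigma> S. e (SOME x. x \<in> X)) = e" if "e \<in> {e \<in> Pi\<^sub>E S A. \<forall>x\<in>S. e (\<sigma> x) = e x}" for e
    proof (rule extensionalityI[of _ S])
      show "e \<in> extensional S" using that by (simp add: PiE_def)
      fix x assume "x \<in> S"
      with that e_some[of e x] show "?h (\<lambda>X\<in>orbits \<sigma> S. e (SOME x. x \<in> X)) x = e x"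
        by (simp add: orbits_def)
    qed simp
  qed
  then have "card {e \<in> Pi\<^sub>E S A. \<forall>x\<in>S. e (\<sigma> x) = e x} = card (\<Pi>\<^sub>E X\<in>orbits \<sigma> S. \<Inter>x\<in>X. A x)"
    by (rule bij_betw_same_card[symmetric])
  also have "\<dots> = (\<Prod>X\<in>orbits \<sigma> S. card (\<Inter>x\<in>X. A x))"
    using S by (simp add: card_PiE orbits_def)
  finally show ?thesis .
qed

section \<open>Sign and number of cycles of a permutation\<close>

lemma sign_cycle_of_list:
  "distinct cs \<Longrightarrow> cs \<noteq> [] \<Longrightarrow> sign (cycle_of_list cs) = (-1) ^ (length cs - 1)"
proof (induction cs rule: cycle_of_list.induct)
  case (1 i j cs)
  have "sign (transpose i j \<circ> cycle_of_list (j # cs)) = sign (transpose i j) * sign (cycle_of_list (j # cs))"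
    by (rule sign_compose) (simp_all add: permutation_swap_id permutation_of_cycle)
  also have "\<dots> = (-1) ^ (length (i # j # cs) - 1)"
    using 1 by (simp add: sign_swap_id)
  finally show ?case by (simp only: cycle_of_list.simps)
qed auto

lemma orbit_cycle_of_list:
  assumes "distinct cs" "x \<in> set cs" shows "orbit (cycle_of_list cs) x = set cs"
proof -
  obtain i where i: "i < length cs" "x = cs ! i" using assms(2) by (auto simp: in_set_conv_nth)
  have pow: "(cycle_of_list cs ^^ n) x = cs ! ((n + i) mod length cs)" for n
  proof -
    have "map (cycle_of_list cs ^^ n) cs ! i = rotate n cs ! i"
      using cyclic_rotation[OF assms(1)] by simp
    then show ?thesis using i by (simp add: nth_rotate)
  qed
  show ?thesis
  proof
    show "orbit (cycle_of_list cs) x \<subseteq> set cs"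
    proof
      fix y assume "y \<in> orbit (cycle_of_list cs) x"
      then obtain n where n: "y = (cycle_of_list cs ^^ n) x" by (auto simp: orbit_altdef)
      from i have "(n + i) mod length cs < length cs" by (intro mod_less_divisor) auto
      then show "y \<in> set cs" unfolding n pow by simp
    qed
    show "set cs \<subseteq> orbit (cycle_of_list cs) x"
    proof
      fix y assume "y \<in> set cs"
      then obtain j where j: "j < length cs" "y = cs ! j" by (auto simp: in_set_conv_nth)
      \<comment> \<open>The exponent is \<open>j - i\<close> modulo the length. Adding the length
        keeps it positive, as \<open>orbit\<close> asks for at least one application.\<close>
      have "(cycle_of_list cs ^^ (j + length cs - i)) x = y" unfolding pow using i j by simp
      moreover have "0 < j + length cs - i" using i by simp
      ultimately show "y \<in> orbit (cycle_of_list cs) x" unfolding orbit_altdef by blast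
    qed
  qed
qed

text \<open>Induction on a decomposition into disjoint cycles. A new cycle of length
  \<open>l\<close> adds \<open>l\<close> points and one orbit and multiplies the sign by
  \<open>(-1) ^ (l - 1)\<close>, so both sides change by the same factor. Disjointness leaves the
  old orbits untouched.\<close>

lemma sign_eq_orbits:
  assumes "\<sigma> permutes S" "finite S"
  shows "sign \<sigma> = (-1) ^ card S * (-1) ^ card (orbits \<sigma> S)"
proof -
  have "cycle_decomp S \<sigma>" by (rule cycle_decomposition[OF assms])
  then have "finite S \<and> \<sigma> permutes S \<and> sign \<sigma> = (-1) ^ card S * (-1) ^ card (orbits \<sigma> S)"
  proof induction
    case empty
    show ?case by (auto simp: orbits_def permutes_def)
  next
    case (comp I p cs)
    show ?case
    proof (cases "cs = []")
      \<comment> \<open>The decomposition may adjoin an empty cycle, which adds neither points nor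
        orbits.\<close>
      case True
      with comp show ?thesis by simp
    next
      case False
      let ?c = "cycle_of_list cs"
      from comp.IH have I: "finite I" "p permutes I"
        and sp: "sign p = (-1) ^ card I * (-1) ^ card (orbits p I)" by auto
      have c: "?c permutes set cs" by (rule cycle_permutes)
      have pc: "(?c \<circ> p) permutes (set cs \<union> I)"
        by (rule permutes_compose) (auto intro: permutes_subset[OF I(2)] permutes_subset[OF c])
      have 1: "orbit (?c \<circ> p) x = orbit p x" if "x \<in> I" for x
      proof (rule orbit_cong)
        show "x \<in> orbit p x" using self_in_orbit[OF I(2,1)] .
        fix s assume "s \<in> orbit p x"
        then have "s \<in> I" using permutes_orbit_subset[OF I(2) that] by blast
        then have "p s \<in> I" using I(2) by (simp add: permutes_in_image)
        then have "p s \<notin> set cs" using comp.hyps by auto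
        then show "(?c \<circ> p) s = p s" by (simp add: id_outside_supp)
      qed
      have 2: "orbit (?c \<circ> p) x = set cs" if "x \<in> set cs" for x
      proof -
        have "orbit (?c \<circ> p) x = orbit ?c x"
        proof (rule orbit_cong)
          show "x \<in> orbit ?c x" using self_in_orbit[OF c] by simp
          fix s assume "s \<in> orbit ?c x"
          then have "s \<notin> I" using orbit_cycle_of_list[OF comp.hyps(2) that] comp.hyps(3) by auto
          then show "(?c \<circ> p) s = ?c s" using I(2) by (simp add: permutes_def)
        qed
        with orbit_cycle_of_list[OF comp.hyps(2) that] show ?thesis by simp
      qed
      have "orbits (?c \<circ> p) (set cs \<union> I) = insert (set cs) (orbits p I)"
        using False 1 2 unfolding orbits_def by (auto simp: image_Un image_iff) 
      moreover have "set cs \<notin> orbits p I"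
      proof
        assume "set cs \<in> orbits p I"
        then have "set cs \<subseteq> I" using permutes_orbit_subset[OF I(2)] by (auto simp: orbits_def)
        with False comp.hyps(3) show False by (cases cs) auto
      qed
      ultimately have n: "card (orbits (?c \<circ> p) (set cs \<union> I)) = Suc (card (orbits p I))"
        using I(1) by (simp add: orbits_def)
      have m: "card (set cs \<union> I) = length cs + card I"
        using I(1) comp.hyps by (simp add: card_Un_disjoint distinct_card)
      have "permutation p" using I permutation_permutes by blast
      then have "sign (?c \<circ> p) = (-1) ^ (length cs - 1) * sign p"
        by (simp only: sign_compose permutation_of_cycle sign_cycle_of_list[OF comp.hyps(2) False])
      also have "\<dots> = (-1) ^ card (set cs \<union> I) * (-1) ^ card (orbits (?c \<circ> p) (set cs \<union> I))"
        unfolding n m sp using False by (cases cs) (auto simp: power_add)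
      finally have "sign (?c \<circ> p) =
        (-1) ^ card (set cs \<union> I) * (-1) ^ card (orbits (?c \<circ> p) (set cs \<union> I))" .
      moreover have "finite (set cs \<union> I)" using I(1) by simp
      ultimately show ?thesis using pc by blast
    qed
  qed
  then show ?thesis by simp
qed

section \<open>Polynomials in p and q\<close>

definition monomial_value :: "(pq_var \<Rightarrow> 'b::comm_ring_1) \<Rightarrow> pq_monomial \<Rightarrow> 'b" where
  "monomial_value v \<mu> = (\<Prod>x\<in>Poly_Mapping.keys \<mu>. v x ^ Poly_Mapping.lookup \<mu> x)"

lemma monomial_value_superset:
  assumes "finite A" "Poly_Mapping.keys \<mu> \<subseteq> A"
  shows "monomial_value v \<mu> = (\<Prod>x\<in>A. v x ^ Poly_Mapping.lookup \<mu> x)"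
  unfolding monomial_value_def using assms
  by (intro prod.mono_neutral_left) (auto simp: in_keys_iff)

lemma monomial_value_zero: "monomial_value v 0 = 1"
  by (simp add: monomial_value_def)

lemma monomial_value_add: "monomial_value v (\<mu> + \<nu>) = monomial_value v \<mu> * monomial_value v \<nu>"
proof -
  let ?A = "Poly_Mapping.keys \<mu> \<union> Poly_Mapping.keys \<nu>"
  have "Poly_Mapping.keys (\<mu> + \<nu>) \<subseteq> ?A" by (rule keys_add)
  then show ?thesis
    by (simp add: monomial_value_superset[of ?A] lookup_add power_add prod.distrib)
qed

lemma monomial_value_sum: "monomial_value v (\<Sum>i\<in>I. f i) = (\<Prod>i\<in>I. monomial_value v (f i))"
  by (induction I rule: infinite_finite_induct) (auto simp: monomial_value_zero monomial_value_add)

lemma monomial_value_single: "monomial_value v (Poly_Mapping.single x (Suc 0)) = v x"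
  by (simp add: monomial_value_def)

text \<open>A larger index set allows two polynomials to be evaluated over the same monomials, even
  where coefficients of their sum cancel.\<close>

lemma poly_subst_superset:
  assumes "\<phi> 0 = 0" "finite A" "Poly_Mapping.keys F \<subseteq> A"
  shows "poly_subst \<phi> v F = (\<Sum>\<mu>\<in>A. \<phi> (Poly_Mapping.lookup F \<mu>) * monomial_value v \<mu>)"
  unfolding poly_subst_def monomial_value_def[symmetric] using assms
  by (intro sum.mono_neutral_left) (auto simp: in_keys_iff)

lemma poly_subst_add:
  assumes \<phi>: "\<And>a b. \<phi> (a + b) = \<phi> a + \<phi> b"
  shows "poly_subst \<phi> v (F + G) = poly_subst \<phi> v F + poly_subst \<phi> v G"
proof -
  have 0: "\<phi> 0 = 0" using \<phi>[of 0 0] by simp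
  let ?A = "Poly_Mapping.keys F \<union> Poly_Mapping.keys G"
  have "Poly_Mapping.keys (F + G) \<subseteq> ?A" by (rule keys_add)
  then show ?thesis
    by (simp add: poly_subst_superset[where \<phi> = \<phi> and A = ?A, OF 0] lookup_add \<phi> distrib_right sum.distrib)
qed

lemma poly_subst_zero: "poly_subst \<phi> v 0 = 0"
  by (simp add: poly_subst_def)

lemma poly_subst_sum:
  assumes "\<And>a b. \<phi> (a + b) = \<phi> a + \<phi> b"
  shows "poly_subst \<phi> v (\<Sum>i\<in>I. F i) = (\<Sum>i\<in>I. poly_subst \<phi> v (F i))"
  by (induction I rule: infinite_finite_induct) (simp_all add: poly_subst_zero poly_subst_add[where \<phi> = \<phi>] assms)

lemma poly_subst_single:
  assumes "\<phi> 0 = 0"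
  shows "poly_subst \<phi> v (Poly_Mapping.single \<mu> c) = \<phi> c * monomial_value v \<mu>"
  by (subst poly_subst_superset[of \<phi> "{\<mu>}"]) (auto simp: assms)

section \<open>Polynomials determined by their values at admissible p and q\<close>

lemma digits_unique:
  fixes N :: nat
  assumes "\<And>j. j < M \<Longrightarrow> a j < N" "\<And>j. j < M \<Longrightarrow> b j < N"
    and "(\<Sum>j<M. a j * N ^ j) = (\<Sum>j<M. b j * N ^ j)" and "j < M"
  shows "a j = b j"
  using assms
proof (induction M arbitrary: a b j)
  case (Suc M)
  have split: "(\<Sum>j<Suc M. c j * N ^ j) = c 0 + N * (\<Sum>j<M. c (Suc j) * N ^ j)" for c :: "nat \<Rightarrow> nat"
    unfolding sum.lessThan_Suc_shift by (simp add: sum_distrib_left mult.left_commute)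
  have N: "0 < N" "a 0 < N" "b 0 < N" using Suc.prems(1,2)[of 0] by auto
  have eq: "a 0 + N * (\<Sum>j<M. a (Suc j) * N ^ j) = b 0 + N * (\<Sum>j<M. b (Suc j) * N ^ j)"
    using Suc.prems(3) unfolding split .
  then have "(a 0 + N * (\<Sum>j<M. a (Suc j) * N ^ j)) mod N = (b 0 + N * (\<Sum>j<M. b (Suc j) * N ^ j)) mod N"
    by (rule arg_cong)
  then have 0: "a 0 = b 0" using N by simp
  then have eq': "(\<Sum>j<M. a (Suc j) * N ^ j) = (\<Sum>j<M. b (Suc j) * N ^ j)" using eq N by simp
  show ?case
  proof (cases j)
    case (Suc i)
    have "a (Suc i) = b (Suc i)"
      by (rule Suc.IH[of "\<lambda>j. a (Suc j)" "\<lambda>j. b (Suc j)"])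
        (use Suc.prems eq' \<open>j = Suc i\<close> in auto)
    with Suc show ?thesis by simp
  qed (use 0 in simp)
qed simp

text \<open>The order is \<open>Q m, ..., Q 1, P 1, ..., P m\<close>. When later indeterminates
  receive larger powers of \<open>t\<close>, the values of the \<open>q\<close> decrease with their
  index, as a shape requires.\<close>

definition nth_indet :: "nat \<Rightarrow> nat \<Rightarrow> pq_var" where
  "nth_indet m j = (if j < m then Q (m - j) else P (Suc j - m))"

lemma bij_betw_nth_indet: "bij_betw (nth_indet m) {..<2 * m} (pq_indets m)"
proof (rule bij_betwI[where g = "\<lambda>x. case x of Q i \<Rightarrow> m - i | P i \<Rightarrow> m + i - 1"])
  show "nth_indet m \<in> {..<2 * m} \<rightarrow> pq_indets m"
  proof
    fix j assume "j \<in> {..<2 * m}"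
    then have "\<not> j < m \<Longrightarrow> Suc j - m \<in> {1..m}" by auto
    then show "nth_indet m j \<in> pq_indets m"
      unfolding nth_indet_def pq_indets_def by (cases "j < m") (auto simp del: atLeastAtMost_iff, auto)
  qed
qed (auto simp: nth_indet_def pq_indets_def)

lemma infinite_roots_imp_zero:
  fixes g :: "complex poly"
  assumes "\<And>t::nat. t0 \<le> t \<Longrightarrow> poly g (of_nat t) = 0"
  shows "g = 0"
proof (rule ccontr)
  assume "g \<noteq> 0"
  then have "finite {x. poly g x = 0}" by (rule poly_roots_finite)
  then have "finite (of_nat ` {t0..} :: complex set)"
    by (rule finite_subset[rotated]) (use assms in auto)
  then have "finite {t0..}" by (rule finite_imageD) (auto simp: inj_on_def)
  then show False using infinite_Ici by blast
qed

text \<open>Kronecker substitution: the indeterminates are replaced by the powers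
  \<open>t ^ (N ^ j)\<close>, which separates the monomials whose exponents are below \<open>N\<close>.\<close>

lemma pq_poly_eq_zeroI:
  assumes m: "1 \<le> m" and F: "F \<in> pq_polys m"
    and zero: "\<And>p q. \<lbrakk>\<forall>i\<in>{1..m}. 0 < p i \<and> 0 < q i; \<forall>i\<in>{1..m}. \<forall>j\<in>{1..m}. i < j \<longrightarrow> q j < q i;
      k \<le> (\<Sum>i=1..m. p i * q i)\<rbrakk> \<Longrightarrow> pq_eval p q F = 0"
  shows "F = 0"
proof -
  obtain N0 where N0: "\<And>\<mu> x. \<mu> \<in> Poly_Mapping.keys F \<Longrightarrow> Poly_Mapping.lookup \<mu> x < N0"
  proof -
    \<comment> \<open>The inserted 0 is the exponent of an indeterminate that does not occur in the
      monomial.\<close>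
    have "finite (insert 0 (\<Union>\<mu>\<in>Poly_Mapping.keys F. Poly_Mapping.lookup \<mu> ` Poly_Mapping.keys \<mu>))" by simp
    then obtain N0 where *: "\<forall>y\<in>insert 0 (\<Union>\<mu>\<in>Poly_Mapping.keys F. Poly_Mapping.lookup \<mu> ` Poly_Mapping.keys \<mu>). y < N0"
      using finite_nat_set_iff_bounded by blast
    have "Poly_Mapping.lookup \<mu> x < N0" if "\<mu> \<in> Poly_Mapping.keys F" for \<mu> x
      using * that by (cases "x \<in> Poly_Mapping.keys \<mu>") (auto simp: in_keys_iff)
    with that show thesis by blast
  qed
  \<comment> \<open>The base exceeds every exponent, so that digits are unique. It is also at least
    2, so that its powers increase strictly.\<close>
  define N where "N = N0 + 2"
  have N: "Poly_Mapping.lookup \<mu> x < N" if "\<mu> \<in> Poly_Mapping.keys F" for \<mu> x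
    using N0[OF that, of x] by (simp add: N_def)
  define e where "e \<mu> = (\<Sum>j<2*m. Poly_Mapping.lookup \<mu> (nth_indet m j) * N ^ j)" for \<mu> :: pq_monomial
  have keys: "Poly_Mapping.keys \<mu> \<subseteq> pq_indets m" if "\<mu> \<in> Poly_Mapping.keys F" for \<mu>
    using F that by (auto simp: pq_polys_def)
  have inj: "inj_on e (Poly_Mapping.keys F)"
  proof (rule inj_onI)
    fix \<mu> \<nu> assume *: "\<mu> \<in> Poly_Mapping.keys F" "\<nu> \<in> Poly_Mapping.keys F" "e \<mu> = e \<nu>"
    have **: "Poly_Mapping.lookup \<mu> (nth_indet m j) = Poly_Mapping.lookup \<nu> (nth_indet m j)" if "j < 2 * m" for j
      by (rule digits_unique[OF N[OF *(1)] N[OF *(2)] _ that]) (use *(3) in \<open>simp add: e_def\<close>)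
    show "\<mu> = \<nu>"
    proof (rule poly_mapping_eqI)
      fix x
      show "Poly_Mapping.lookup \<mu> x = Poly_Mapping.lookup \<nu> x"
      proof (cases "x \<in> pq_indets m")
        case True
        then obtain j where "j < 2 * m" "x = nth_indet m j"
          using bij_betw_nth_indet[of m] by (auto simp: bij_betw_def)
        with ** show ?thesis by simp
      next
        case False
        then have "x \<notin> Poly_Mapping.keys \<mu>" "x \<notin> Poly_Mapping.keys \<nu>" using keys * by blast+
        then show ?thesis by (simp add: in_keys_iff)
      qed
    qed
  qed
  \<comment> \<open>This is the univariate polynomial obtained from \<open>F\<close> by the
    substitution. Since \<open>e\<close> is injective on the monomials of \<open>F\<close>, no two
    coefficients are merged.\<close>
  define g where "g = (\<Sum>\<mu>\<in>Poly_Mapping.keys F. monom (complex_of_real (Poly_Mapping.lookup F \<mu>)) (e \<mu>))"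
  \<comment> \<open>A value \<open>t\<close> of at least 2 makes the \<open>q\<close> strictly
    decreasing. A value of at least \<open>k\<close> makes the first block alone contain
    \<open>k\<close> cells.\<close>
  have "poly g (of_nat t) = 0" if t: "k + 2 \<le> t" for t
  proof -
    define p where "p i = t ^ (N ^ (m + i - 1))" for i
    define q where "q i = t ^ (N ^ (m - i))" for i
    define v :: "pq_var \<Rightarrow> complex" where "v x = (case x of P i \<Rightarrow> of_nat (p i) | Q i \<Rightarrow> of_nat (q i))" for x
    have v: "v (nth_indet m j) = of_nat t ^ (N ^ j)" if "j < 2 * m" for j
      using that by (auto simp: v_def nth_indet_def p_def q_def)
    have "monomial_value v \<mu> = of_nat t ^ e \<mu>" if \<mu>: "\<mu> \<in> Poly_Mapping.keys F" for \<mu>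
    proof -
      have "monomial_value v \<mu> = (\<Prod>x\<in>pq_indets m. v x ^ Poly_Mapping.lookup \<mu> x)"
        by (rule monomial_value_superset) (use keys[OF \<mu>] in \<open>auto simp: pq_indets_def\<close>)
      also have "\<dots> = (\<Prod>j<2*m. v (nth_indet m j) ^ Poly_Mapping.lookup \<mu> (nth_indet m j))"
        by (rule prod.reindex_bij_betw[OF bij_betw_nth_indet, symmetric])
      also have "\<dots> = of_nat t ^ e \<mu>"
        unfolding e_def power_sum by (intro prod.cong) (auto simp: v power_mult[symmetric] mult.commute)
      finally show ?thesis .
    qed
    then have "poly g (of_nat t) = pq_eval p q F"
      by (simp add: g_def poly_sum poly_monom pq_eval_def v_def[symmetric] poly_subst_def monomial_value_def[symmetric])
    also have "\<dots> = 0"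
    proof (rule zero)
      show "\<forall>i\<in>{1..m}. 0 < p i \<and> 0 < q i" using t by (simp add: p_def q_def)
      show "\<forall>i\<in>{1..m}. \<forall>j\<in>{1..m}. i < j \<longrightarrow> q j < q i"
        using t by (auto simp: q_def N_def intro!: power_strict_increasing)
      have "t \<le> t ^ (N ^ m + N ^ (m - 1))" using t by (intro self_le_power) (auto simp: N_def)
      then have "t \<le> p 1 * q 1" by (simp add: p_def q_def power_add)
      also have "\<dots> \<le> (\<Sum>i=1..m. p i * q i)" by (rule member_le_sum) (use m in auto)
      finally show "k \<le> (\<Sum>i=1..m. p i * q i)" using t by simp
    qed
    finally show ?thesis .
  qed
  then have g: "g = 0" by (rule infinite_roots_imp_zero)
  have "\<mu> \<notin> Poly_Mapping.keys F" for \<mu>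
  proof
    assume \<mu>: "\<mu> \<in> Poly_Mapping.keys F"
    have "coeff g (e \<mu>) = (\<Sum>\<nu>\<in>Poly_Mapping.keys F. if \<nu> = \<mu> then complex_of_real (Poly_Mapping.lookup F \<nu>) else 0)"
      unfolding g_def coeff_sum coeff_monom
      by (intro sum.cong refl) (use inj \<mu> in \<open>auto simp: inj_on_def\<close>)
    also have "\<dots> = complex_of_real (Poly_Mapping.lookup F \<mu>)" using \<mu> by simp
    finally show False using \<mu> g by (simp add: in_keys_iff)
  qed
  then show "F = 0" by (metis ex_in_conv keys_eq_empty)
qed

text \<open>The definite description in \<open>stanley_poly\<close> calls for uniqueness: the
  difference of two candidates vanishes at all admissible values, hence is zero.\<close>

lemma stanley_poly_eqI:
  assumes m: "1 \<le> m" and F: "is_stanley_poly m k F"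
  shows "stanley_poly m k = F"
proof -
  have "G = F" if G: "is_stanley_poly m k G" for G
  proof -
    define H where "H = G + Poly_Mapping.map uminus F"
    have lookup_H: "Poly_Mapping.lookup H \<mu> = Poly_Mapping.lookup G \<mu> - Poly_Mapping.lookup F \<mu>" for \<mu>
      by (simp add: H_def lookup_add Poly_Mapping.map.rep_eq when_def)
    have add: "complex_of_real (a + b) = complex_of_real a + complex_of_real b" for a b by simp
    have "H + F = G" by (rule poly_mapping_eqI) (simp add: lookup_add lookup_H)
    then have eval: "pq_eval p q H = pq_eval p q G - pq_eval p q F" for p q
      unfolding pq_eval_def using poly_subst_add[where \<phi> = complex_of_real, OF add]
      by (metis add_diff_cancel_right')
    have "H = 0"
    proof (rule pq_poly_eq_zeroI[OF m])
      show "H \<in> pq_polys m"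
        unfolding pq_polys_def
      proof (intro CollectI ballI)
        fix \<mu> assume "\<mu> \<in> Poly_Mapping.keys H"
        then have "\<mu> \<in> Poly_Mapping.keys G \<or> \<mu> \<in> Poly_Mapping.keys F"
          by (auto simp: in_keys_iff lookup_H)
        then show "Poly_Mapping.keys \<mu> \<subseteq> pq_indets m"
          using F G unfolding is_stanley_poly_def pq_polys_def by blast
      qed
      show "pq_eval p q H = 0"
        if "\<forall>i\<in>{1..m}. 0 < p i \<and> 0 < q i" "\<forall>i\<in>{1..m}. \<forall>j\<in>{1..m}. i < j \<longrightarrow> q j < q i"
          "k \<le> (\<Sum>i=1..m. p i * q i)" for p q
        using that F G unfolding eval is_stanley_poly_def by simp
    qed
    with lookup_H have "Poly_Mapping.lookup G \<mu> = Poly_Mapping.lookup F \<mu>" for \<mu> by simp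
    then show "G = F" by (rule poly_mapping_eqI)
  qed
  with F show ?thesis unfolding stanley_poly_def by (rule the_equality)
qed

lemma pq_Const_add: "pq_Const (a + b) = pq_Const a + pq_Const b"
  by (simp add: pq_Const_def single_add)

lemma pq_Const_zero: "pq_Const 0 = 0"
  by (simp add: pq_Const_def)

lemma lookup_hom_component:
  "Poly_Mapping.lookup (hom_component d F) \<mu> =
    (if total_degree \<mu> = d then Poly_Mapping.lookup F \<mu> else 0)"
proof -
  have "Poly_Mapping.lookup (hom_component d F) \<mu> =
    (\<Sum>\<nu> | \<nu> \<in> Poly_Mapping.keys F \<and> total_degree \<nu> = d. if \<nu> = \<mu> then Poly_Mapping.lookup F \<nu> else 0)"
    unfolding hom_component_def lookup_sum lookup_single when_def ..
  also have "\<dots> = (if total_degree \<mu> = d then Poly_Mapping.lookup F \<mu> else 0)"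
    by (auto simp: in_keys_iff)
  finally show ?thesis .
qed

text \<open>Only nonzero coefficients are tested by \<open>pq_positive\<close>, so nonnegativity of
  all coefficients suffices in every degree.\<close>

lemma pq_positive_hom_component:
  assumes "\<And>\<mu>. 0 \<le> Poly_Mapping.lookup F \<mu>" shows "pq_positive (hom_component d F)"
  unfolding pq_positive_def
proof
  fix \<mu> assume "\<mu> \<in> Poly_Mapping.keys (hom_component d F)"
  then have "Poly_Mapping.lookup (hom_component d F) \<mu> \<noteq> 0" by (simp add: in_keys_iff)
  with assms[of \<mu>] show "0 < Poly_Mapping.lookup (hom_component d F) \<mu>"
    by (auto simp: lookup_hom_component split: if_splits)
qed

section \<open>The Stanley-Feray formula\<close>

text \<open>Row lengths are separated from block indices, so that rows can be coloured by their
  block before \<open>q\<close> is applied.\<close>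

definition block_list :: "nat \<Rightarrow> (nat \<Rightarrow> nat) \<Rightarrow> nat list" where
  "block_list m p = concat (map (\<lambda>i. replicate (p i) i) [1..<Suc m])"

lemma pq_shape_eq: "pq_shape m p q = map q (block_list m p)"
  by (simp add: pq_shape_def block_list_def map_concat comp_def)

lemma length_pq_shape: "length (pq_shape m p q) = length (block_list m p)"
  by (simp add: pq_shape_eq)

lemma nth_pq_shape: "r < length (block_list m p) \<Longrightarrow> pq_shape m p q ! r = q (block_list m p ! r)"
  by (simp add: pq_shape_eq)

lemma set_block_list: "set (block_list m p) \<subseteq> {1..m}"
  by (auto simp: block_list_def)

lemma nth_block_list: "r < length (block_list m p) \<Longrightarrow> block_list m p ! r \<in> {1..m}"
  using set_block_list nth_mem by blast

lemma sum_list_pq_shape: "sum_list (pq_shape m p q) = (\<Sum>i=1..m. p i * q i)"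
  by (induction m) (simp_all add: pq_shape_def sum_list_replicate)

lemma sorted_pq_shape:
  assumes "\<forall>i\<in>{1..m}. \<forall>j\<in>{1..m}. i < j \<longrightarrow> q j < q (i::nat)"
  shows "sorted_wrt (\<ge>) (pq_shape m p q)"
  using assms
proof (induction m)
  case (Suc m)
  have "pq_shape (Suc m) p q = pq_shape m p q @ replicate (p (Suc m)) (q (Suc m))"
    by (simp add: pq_shape_def)
  moreover have "q (Suc m) \<le> x" if x: "x \<in> set (pq_shape m p q)" for x
  proof -
    obtain i where "i \<in> {1..m}" "x = q i" using x set_block_list[of m p] by (auto simp: pq_shape_eq)
    moreover have "q (Suc m) < q i" using Suc.prems \<open>i \<in> {1..m}\<close> by auto
    ultimately show ?thesis by simp
  qed
  moreover have "sorted_wrt (\<ge>) (replicate n x)" for n and x :: nat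
    by (induction n) auto
  moreover have "sorted_wrt (\<ge>) (pq_shape m p q)" using Suc by auto
  ultimately show ?case by (auto simp: sorted_wrt_append)
qed (simp add: pq_shape_def)

section \<open>Counting compatible maps for the shape p x q\<close>

lemma card_block:
  assumes "i \<in> {1..m}"
  shows "card {r. r < length (block_list m p) \<and> block_list m p ! r = i} = p i"
proof -
  have "length (filter (\<lambda>x. x = i) (block_list m p)) = (if i \<in> {1..m} then p i else 0)"
    by (induction m) (auto simp: block_list_def le_Suc_eq)
  with assms show ?thesis by (simp add: length_filter_conv_card)
qed

text \<open>As functions on letters invariant under \<open>\<rho>\<close>, these are the colourings
  of the cycles of \<open>\<rho>\<close> by blocks.\<close>

definition colourings :: "nat \<Rightarrow> nat \<Rightarrow> (nat \<Rightarrow> nat) \<Rightarrow> (nat \<Rightarrow> nat) set" where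
  "colourings m k \<rho> = {\<phi> \<in> {..<k} \<rightarrow>\<^sub>E {1..m}. \<forall>x\<in>{..<k}. \<phi> (\<rho> x) = \<phi> x}"

lemma finite_colourings: "finite (colourings m k \<rho>)"
  unfolding colourings_def by (rule finite_subset[of _ "{..<k} \<rightarrow>\<^sub>E {1..m}"]) (auto simp: finite_PiE)

text \<open>A compatible map sends each point to a cell, that is to a row in some block of equal rows
  and to a column shorter than that row; \<open>\<phi>\<close> records the block.\<close>

lemma card_compatible_blocks:
  fixes p q :: "nat \<Rightarrow> nat" and m :: nat
  assumes \<rho>: "\<rho> permutes {..<k}" and \<sigma>: "\<sigma> permutes {..<k}"
  defines "b \<equiv> block_list m p" and "\<omega> \<equiv> pq_shape m p q"
  shows "card {u \<in> {..<k} \<rightarrow>\<^sub>E {..<sum_list \<omega>}. compatible \<omega> k \<rho> \<sigma> u} =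
    (\<Sum>\<phi>\<in>colourings m k \<rho>.
      card {f \<in> \<Pi>\<^sub>E x\<in>{..<k}. {r. r < length b \<and> b ! r = \<phi> x}. \<forall>x\<in>{..<k}. f (\<rho> x) = f x} *
      card {e \<in> \<Pi>\<^sub>E x\<in>{..<k}. {..<q (\<phi> x)}. \<forall>x\<in>{..<k}. e (\<sigma> x) = e x})"
proof -
  define A where "A \<phi> = {f \<in> \<Pi>\<^sub>E x\<in>{..<k}. {r. r < length b \<and> b ! r = \<phi> x}. \<forall>x\<in>{..<k}. f (\<rho> x) = f x}" for \<phi>
  define B where "B \<phi> = {e \<in> \<Pi>\<^sub>E x\<in>{..<k}. {..<q (\<phi> x)}. \<forall>x\<in>{..<k}. e (\<sigma> x) = e x}" for \<phi>
  define Z where "Z = {u \<in> {..<k} \<rightarrow>\<^sub>E {..<sum_list \<omega>}. compatible \<omega> k \<rho> \<sigma> u}"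
  let ?T = "tableau \<omega>" and ?T' = "inv_into {..<sum_list \<omega>} (tableau \<omega>)"
  have cells: "(r, c) \<in> cells \<omega> \<longleftrightarrow> r < length b \<and> c < q (b ! r)" for r c
    by (auto simp: cells_def \<omega>_def b_def length_pq_shape nth_pq_shape)
  have T: "row \<omega> y < length b" "col \<omega> y < q (b ! row \<omega> y)" if "y < sum_list \<omega>" for y
    using bij_betwE[OF bij_betw_tableau[of \<omega>]] that cells[of "row \<omega> y" "col \<omega> y"] by auto
  have T': "?T (?T' (r, c)) = (r, c)" "?T' (r, c) < sum_list \<omega>" if "r < length b" "c < q (b ! r)" for r c
    using bij_betw_inv_into_right[OF bij_betw_tableau[of \<omega>], of "(r, c)"]
      bij_betwE[OF bij_betw_inv_into[OF bij_betw_tableau[of \<omega>]]] cells[of r c] that by auto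
  have T'T: "?T' (?T y) = y" if "y < sum_list \<omega>" for y
    using bij_betw_inv_into_left[OF bij_betw_tableau[of \<omega>]] that by simp
  have lt: "\<rho> x < k" "\<sigma> x < k" if "x < k" for x using that \<rho> \<sigma> by (simp_all add: permutes_lt)
  \<comment> \<open>A placement is split into its blocks, rows and columns. Conversely, row and
    column determine the entry through the tableau, and the block is that of the row.\<close>
  have "bij_betw (\<lambda>u. (\<lambda>x\<in>{..<k}. b ! row \<omega> (u x), (\<lambda>x\<in>{..<k}. row \<omega> (u x), \<lambda>x\<in>{..<k}. col \<omega> (u x))))
    Z (Sigma (colourings m k \<rho>) (\<lambda>\<phi>. A \<phi> \<times> B \<phi>))"
  proof (rule bij_betwI[where g = "\<lambda>(\<phi>, f, e). \<lambda>x\<in>{..<k}. ?T' (f x, e x)"], goal_cases)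
    case 1
    show ?case
    proof (rule Pi_I)
      fix u assume "u \<in> Z"
      then have u: "\<And>x. x < k \<Longrightarrow> u x < sum_list \<omega>" and c: "compatible \<omega> k \<rho> \<sigma> u" by (auto simp: Z_def)
      have "(\<lambda>x\<in>{..<k}. b ! row \<omega> (u x)) \<in> colourings m k \<rho>"
        using u T(1) nth_block_list[of _ m p] c lt by (auto simp: colourings_def b_def compatible_def)
      moreover have "(\<lambda>x\<in>{..<k}. row \<omega> (u x)) \<in> A (\<lambda>x\<in>{..<k}. b ! row \<omega> (u x))"
        using u T(1) c lt by (auto simp: A_def compatible_def)
      moreover have "(\<lambda>x\<in>{..<k}. col \<omega> (u x)) \<in> B (\<lambda>x\<in>{..<k}. b ! row \<omega> (u x))"
        using u T(2) c lt by (auto simp: B_def compatible_def)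
      ultimately show "(\<lambda>x\<in>{..<k}. b ! row \<omega> (u x), (\<lambda>x\<in>{..<k}. row \<omega> (u x), \<lambda>x\<in>{..<k}. col \<omega> (u x)))
        \<in> Sigma (colourings m k \<rho>) (\<lambda>\<phi>. A \<phi> \<times> B \<phi>)" by blast
    qed
  next
    case 2
    show ?case
    proof (rule Pi_I)
      fix z assume "z \<in> Sigma (colourings m k \<rho>) (\<lambda>\<phi>. A \<phi> \<times> B \<phi>)"
      then obtain \<phi> f e where z: "z = (\<phi>, f, e)" "f \<in> A \<phi>" "e \<in> B \<phi>" by auto
      have f: "f x < length b" "f (\<rho> x) = f x" and e: "e x < q (b ! f x)" "e (\<sigma> x) = e x" if "x < k" for x
        using z that by (auto simp: A_def B_def Pi_iff PiE_def)
      have "row \<omega> (?T' (f (\<rho> x), e (\<rho> x))) = row \<omega> (?T' (f x, e x))" if "x < k" for x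
        using T'(1)[OF f(1)[OF that] e(1)[OF that]] T'(1)[OF f(1)[OF lt(1)] e(1)[OF lt(1)], OF that that] f(2) that lt by simp
      moreover have "col \<omega> (?T' (f (\<sigma> x), e (\<sigma> x))) = col \<omega> (?T' (f x, e x))" if "x < k" for x
        using T'(1)[OF f(1)[OF that] e(1)[OF that]] T'(1)[OF f(1)[OF lt(2)] e(1)[OF lt(2)], OF that that] e(2) that lt by simp
      ultimately show "(case z of (\<phi>, f, e) \<Rightarrow> \<lambda>x\<in>{..<k}. ?T' (f x, e x)) \<in> Z"
        using lt T'(2) f e by (simp add: Z_def z(1) compatible_def)
    qed
  next
    case (3 u)
    then have uE: "u \<in> {..<k} \<rightarrow>\<^sub>E {..<sum_list \<omega>}" by (simp only: Z_def mem_Collect_eq)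
    have u: "u x < sum_list \<omega>" if "x < k" for x using PiE_mem[OF uE, of x] that by simp
    have "u \<in> extensional {..<k}" using uE by (simp only: PiE_def Int_iff)
    then    have "(\<lambda>x\<in>{..<k}. ?T' ((\<lambda>x\<in>{..<k}. row \<omega> (u x)) x, (\<lambda>x\<in>{..<k}. col \<omega> (u x)) x)) = u"
      by (rule extensionalityI[OF restrict_extensional]) (simp add: T'T u)
    then show ?case by (simp only: prod.case)
  next
    case (4 z)
    then obtain \<phi> f e where z: "z = (\<phi>, f, e)" "\<phi> \<in> colourings m k \<rho>" "f \<in> A \<phi>" "e \<in> B \<phi>" by auto
    have f: "f x < length b" "b ! f x = \<phi> x" and e: "e x < q (b ! f x)" if "x < k" for x
      using z that by (auto simp: A_def B_def Pi_iff PiE_def)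
    have ext: "\<phi> \<in> extensional {..<k}" "f \<in> extensional {..<k}" "e \<in> extensional {..<k}"
      using z by (auto simp: colourings_def A_def B_def PiE_def)
    have "(\<lambda>x\<in>{..<k}. b ! row \<omega> ((\<lambda>x\<in>{..<k}. ?T' (f x, e x)) x)) = \<phi>"
      "(\<lambda>x\<in>{..<k}. row \<omega> ((\<lambda>x\<in>{..<k}. ?T' (f x, e x)) x)) = f"
      "(\<lambda>x\<in>{..<k}. col \<omega> ((\<lambda>x\<in>{..<k}. ?T' (f x, e x)) x)) = e"
      by (rule extensionalityI[OF restrict_extensional]; use ext T'(1)[OF f(1) e] f(2) in simp)+
    then show ?case unfolding z(1) by simp
  qed
  then have "card Z = card (Sigma (colourings m k \<rho>) (\<lambda>\<phi>. A \<phi> \<times> B \<phi>))"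
    by (rule bij_betw_same_card)
  also have "\<dots> = (\<Sum>\<phi>\<in>colourings m k \<rho>. card (A \<phi> \<times> B \<phi>))"
  proof (rule card_SigmaI)
    show "\<forall>\<phi>\<in>colourings m k \<rho>. finite (A \<phi> \<times> B \<phi>)"
      unfolding A_def B_def by (intro ballI finite_cartesian_product finite_Collect_conjI disjI1) (simp_all add: finite_PiE)
  qed (rule finite_colourings)
  finally show ?thesis unfolding Z_def A_def B_def by (simp add: card_cartesian_product)
qed

lemma orbits_cases:
  assumes "\<sigma> permutes S" "finite S" "X \<in> orbits \<sigma> S"
  obtains x where "x \<in> S" "x \<in> X" "X = orbit \<sigma> x" "X \<subseteq> S" "finite X"
proof -
  obtain x where x: "x \<in> S" "X = orbit \<sigma> x" using assms(3) by (auto simp: orbits_def)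
  moreover have "X \<subseteq> S" using permutes_orbit_subset[OF assms(1) x(1)] x(2) by simp
  moreover have "x \<in> X" using self_in_orbit[OF assms(1,2)] x(2) by simp
  ultimately show thesis using that assms(2) finite_subset by metis
qed

text \<open>On a cycle of \<open>\<rho>\<close> the colour is constant, so the maximum merely names
  it, and the common row is any of the rows in that block. On a cycle of \<open>\<sigma>\<close> the
  common column must fit into the rows of every colour met. As \<open>q\<close> is decreasing, the
  largest colour gives the tightest bound.\<close>

lemma card_compatible:
  fixes p q :: "nat \<Rightarrow> nat" and m :: nat
  assumes \<rho>: "\<rho> permutes {..<k}" and \<sigma>: "\<sigma> permutes {..<k}"
    and q: "\<forall>i\<in>{1..m}. \<forall>j\<in>{1..m}. i < j \<longrightarrow> q j < q i"
  defines "\<omega> \<equiv> pq_shape m p q"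
  shows "card {u \<in> {..<k} \<rightarrow>\<^sub>E {..<sum_list \<omega>}. compatible \<omega> k \<rho> \<sigma> u} =
    (\<Sum>\<phi>\<in>colourings m k \<rho>. (\<Prod>X\<in>orbits \<rho> {..<k}. p (Max (\<phi> ` X))) * (\<Prod>X\<in>orbits \<sigma> {..<k}. q (Max (\<phi> ` X))))"
  unfolding \<omega>_def card_compatible_blocks[OF \<rho> \<sigma>] card_invariant_functions[OF \<rho> finite_lessThan]
    card_invariant_functions[OF \<sigma> finite_lessThan]
proof (intro sum.cong refl arg_cong2[where f = "(*)"] prod.cong)
  fix \<phi> X assume \<phi>: "\<phi> \<in> colourings m k \<rho>" and X: "X \<in> orbits \<rho> {..<k}"
  obtain x where x: "x \<in> {..<k}" "x \<in> X" "X = orbit \<rho> x" "X \<subseteq> {..<k}"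
    by (rule orbits_cases[OF \<rho> finite_lessThan X])
  have const: "\<phi> y = \<phi> x" if "y \<in> X" for y
    by (rule invariant_on_orbit[OF \<rho> x(1)]) (use \<phi> that x(3) in \<open>auto simp: colourings_def\<close>)
  define S where "S i = {r. r < length (block_list m p) \<and> block_list m p ! r = i}" for i
  have "\<phi> ` X = (\<lambda>_. \<phi> x) ` X" by (rule image_cong[OF refl const])
  then have "\<phi> ` X = {\<phi> x}" using x(2) by auto
  moreover have "(\<Inter>y\<in>X. S (\<phi> y)) = (\<Inter>y\<in>X. S (\<phi> x))"
    by (rule INF_cong[OF refl]) (simp only: const)
  then have "(\<Inter>y\<in>X. S (\<phi> y)) = S (\<phi> x)" using x(2) by auto
  moreover have "\<phi> x \<in> {1..m}" using \<phi> x(1) by (auto simp: colourings_def)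
  ultimately show "card (\<Inter>y\<in>X. {r. r < length (block_list m p) \<and> block_list m p ! r = \<phi> y}) = p (Max (\<phi> ` X))"
    unfolding S_def using card_block by simp
next
  fix \<phi> X assume \<phi>: "\<phi> \<in> colourings m k \<rho>" and X: "X \<in> orbits \<sigma> {..<k}"
  obtain x where x: "x \<in> X" "X \<subseteq> {..<k}" "finite X"
    by (rule orbits_cases[OF \<sigma> finite_lessThan X])
  have \<phi>m: "\<phi> y \<in> {1..m}" if "y \<in> X" for y using \<phi> x(2) that by (auto simp: colourings_def)
  have "Max (\<phi> ` X) \<in> \<phi> ` X" using x by (intro Max_in) auto
  then obtain z where z: "z \<in> X" "Max (\<phi> ` X) = \<phi> z" by auto
  have "q (\<phi> z) \<le> q (\<phi> y)" if "y \<in> X" for y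
  proof (cases "\<phi> y = \<phi> z")
    case False
    have "\<phi> y \<le> Max (\<phi> ` X)" using that x by simp
    with False z(2) have "\<phi> y < \<phi> z" by simp
    with q \<phi>m[OF that] \<phi>m[OF z(1)] show ?thesis by (simp add: less_imp_le)
  qed simp
  then have "(\<Inter>y\<in>X. {..<q (\<phi> y)}) = {..<q (\<phi> z)}" using z(1) by (auto intro: less_le_trans)
  then show "card (\<Inter>y\<in>X. {..<q (\<phi> y)}) = q (Max (\<phi> ` X))" by (simp add: z(2))
qed

section \<open>The Stanley-Feray polynomial and its signs\<close>

definition colour_monomial :: "nat \<Rightarrow> (nat \<Rightarrow> nat) \<Rightarrow> (nat \<Rightarrow> nat) \<Rightarrow> (nat \<Rightarrow> nat) \<Rightarrow> pq_monomial" where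
  "colour_monomial k \<rho> \<sigma> \<phi> =
    (\<Sum>X\<in>orbits \<rho> {..<k}. Poly_Mapping.single (P (Max (\<phi> ` X))) (Suc 0)) +
    (\<Sum>X\<in>orbits \<sigma> {..<k}. Poly_Mapping.single (Q (Max (\<phi> ` X))) (Suc 0))"

text \<open>The factor \<open>\<sigma>\<close> in the factorisation \<open>\<rho> \<sigma> = c\<^sup>-\<^sup>1\<close> of the inverse of the long cycle.\<close>

definition complement :: "nat \<Rightarrow> (nat \<Rightarrow> nat) \<Rightarrow> nat \<Rightarrow> nat" where
  "complement k \<rho> = inv \<rho> \<circ> inv (cycle_of_list [0..<k])"

text \<open>This is the signed sum of the counts in \<open>card_compatible\<close> for the
  factorisations of the inverse long cycle, with the values of \<open>p\<close> and \<open>q\<close>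
  replaced by indeterminates.\<close>

definition feray_poly :: "nat \<Rightarrow> nat \<Rightarrow> pq_poly" where
  "feray_poly m k = (\<Sum>\<rho> | \<rho> permutes {..<k}. \<Sum>\<phi>\<in>colourings m k \<rho>.
     Poly_Mapping.single (colour_monomial k \<rho> (complement k \<rho>) \<phi>) (of_int (sign (complement k \<rho>))))"

lemma cycle_permutes_upt: "cycle_of_list [0..<k] permutes {..<k}"
  using cycle_permutes[of "[0..<k]"] by (simp add: lessThan_atLeast0)

lemma complement_permutes: "\<rho> permutes {..<k} \<Longrightarrow> complement k \<rho> permutes {..<k}"
  unfolding complement_def by (intro permutes_compose permutes_inv cycle_permutes_upt)

lemma monomial_value_colour:
  "monomial_value v (colour_monomial k \<rho> \<sigma> \<phi>) =
    (\<Prod>X\<in>orbits \<rho> {..<k}. v (P (Max (\<phi> ` X)))) * (\<Prod>X\<in>orbits \<sigma> {..<k}. v (Q (Max (\<phi> ` X))))"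
  by (simp add: colour_monomial_def monomial_value_add monomial_value_sum monomial_value_single)

lemma keys_colour_monomial:
  assumes \<rho>: "\<rho> permutes {..<k}" and \<sigma>: "\<sigma> permutes {..<k}" and \<phi>: "\<phi> \<in> colourings m k \<rho>"
  shows "Poly_Mapping.keys (colour_monomial k \<rho> \<sigma> \<phi>) \<subseteq> pq_indets m"
proof
  fix y assume y: "y \<in> Poly_Mapping.keys (colour_monomial k \<rho> \<sigma> \<phi>)"
  have "\<exists>\<tau>. \<tau> permutes {..<k} \<and> (\<exists>X\<in>orbits \<tau> {..<k}. y = P (Max (\<phi> ` X)) \<or> y = Q (Max (\<phi> ` X)))"
  proof (rule ccontr)
    assume neg: "\<not> ?thesis"
    have "P (Max (\<phi> ` X)) \<noteq> y" if "X \<in> orbits \<rho> {..<k}" for X using neg \<rho> that by blast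
    moreover have "Q (Max (\<phi> ` X)) \<noteq> y" if "X \<in> orbits \<sigma> {..<k}" for X using neg \<sigma> that by blast
    ultimately have "Poly_Mapping.lookup (colour_monomial k \<rho> \<sigma> \<phi>) y = 0"
      unfolding colour_monomial_def lookup_add lookup_sum lookup_single
      by simp
    with y show False by (simp add: in_keys_iff)
  qed
  then obtain \<tau> X where \<tau>: "\<tau> permutes {..<k}" and X: "X \<in> orbits \<tau> {..<k}"
    and yX: "y = P (Max (\<phi> ` X)) \<or> y = Q (Max (\<phi> ` X))" by blast
  obtain x where x: "x \<in> X" "X \<subseteq> {..<k}" "finite X" by (rule orbits_cases[OF \<tau> finite_lessThan X])
  have "Max (\<phi> ` X) \<in> \<phi> ` X" using x by (intro Max_in) auto
  then have "Max (\<phi> ` X) \<in> {1..m}" using \<phi> x(2) by (auto simp: colourings_def)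
  with yX show "y \<in> pq_indets m" by (auto simp: pq_indets_def)
qed

lemma feray_poly_in_pq_polys: "feray_poly m k \<in> pq_polys m"
  unfolding pq_polys_def
proof (intro CollectI ballI)
  fix \<mu> assume \<mu>: "\<mu> \<in> Poly_Mapping.keys (feray_poly m k)"
  have "\<exists>\<rho> \<phi>. \<rho> permutes {..<k} \<and> \<phi> \<in> colourings m k \<rho> \<and> colour_monomial k \<rho> (complement k \<rho>) \<phi> = \<mu>"
  proof (rule ccontr)
    assume "\<not> ?thesis"
    then have "Poly_Mapping.lookup (feray_poly m k) \<mu> = 0"
      unfolding feray_poly_def lookup_sum lookup_single
      by (auto simp: when_def intro!: sum.neutral)
    with \<mu> show False by (simp add: in_keys_iff)
  qed
  then show "Poly_Mapping.keys \<mu> \<subseteq> pq_indets m"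
    using keys_colour_monomial complement_permutes by blast
qed

text \<open>Evaluation turns the monomials back into the products counted by
  \<open>card_compatible\<close>. The resulting signed sum is the normalized character by
  \<open>character_eq_sum_factorisations\<close>, applied to the long cycle.\<close>

lemma is_stanley_poly_feray: "is_stanley_poly m k (feray_poly m k)"
  unfolding is_stanley_poly_def
proof (intro conjI allI impI feray_poly_in_pq_polys)
  fix p q :: "nat \<Rightarrow> nat"
  assume asm: "(\<forall>i\<in>{1..m}. 0 < p i \<and> 0 < q i) \<and> (\<forall>i\<in>{1..m}. \<forall>j\<in>{1..m}. i < j \<longrightarrow> q j < q i) \<and>
    k \<le> (\<Sum>i=1..m. p i * q i)"
  then have q: "\<forall>i\<in>{1..m}. \<forall>j\<in>{1..m}. i < j \<longrightarrow> q j < q i" by blast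
  let ?\<omega> = "pq_shape m p q"
  have k: "k \<le> sum_list ?\<omega>" using asm by (simp add: sum_list_pq_shape)
  define v :: "pq_var \<Rightarrow> complex" where "v x = (case x of P i \<Rightarrow> of_nat (p i) | Q i \<Rightarrow> of_nat (q i))" for x
  have "pq_eval p q (feray_poly m k) = (\<Sum>\<rho> | \<rho> permutes {..<k}. \<Sum>\<phi>\<in>colourings m k \<rho>.
      of_int (sign (complement k \<rho>)) * monomial_value v (colour_monomial k \<rho> (complement k \<rho>) \<phi>))"
    unfolding pq_eval_def feray_poly_def v_def[symmetric]
    by (simp add: poly_subst_sum poly_subst_single)
  also have "\<dots> = (\<Sum>\<rho> | \<rho> permutes {..<k}. of_int (sign (complement k \<rho>)) *
      of_nat (card {u \<in> {..<k} \<rightarrow>\<^sub>E {..<sum_list ?\<omega>}. compatible ?\<omega> k \<rho> (complement k \<rho>) u}))"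
  proof (intro sum.cong refl)
    fix \<rho> assume "\<rho> \<in> {\<rho>. \<rho> permutes {..<k}}"
    then have \<rho>: "\<rho> permutes {..<k}" by simp
    show "(\<Sum>\<phi>\<in>colourings m k \<rho>.
      of_int (sign (complement k \<rho>)) * monomial_value v (colour_monomial k \<rho> (complement k \<rho>) \<phi>)) =
      of_int (sign (complement k \<rho>)) *
      of_nat (card {u \<in> {..<k} \<rightarrow>\<^sub>E {..<sum_list ?\<omega>}. compatible ?\<omega> k \<rho> (complement k \<rho>) u})"
      unfolding card_compatible[OF \<rho> complement_permutes[OF \<rho>] q] monomial_value_colour
      by (simp add: v_def sum_distrib_left)
  qed
  also have "\<dots> = normalized_character ?\<omega> k"
    unfolding normalized_character_def complement_def
    by (rule character_eq_sum_factorisations[OF sorted_pq_shape[OF q] k cycle_permutes_upt, symmetric])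
  finally show "pq_eval p q (feray_poly m k) = normalized_character ?\<omega> k" .
qed

lemma prod_pq_Var:
  "(\<Prod>i\<in>I. pq_Var (f i)) = Poly_Mapping.single (\<Sum>i\<in>I. Poly_Mapping.single (f i) (Suc 0)) 1"
  by (induction I rule: infinite_finite_induct) (simp_all add: pq_Var_def mult_single)

text \<open>Let \<open>c\<close> be the number of cycles of the complementary factor. Its sign is
  \<open>(-1) ^ k * (-1) ^ c\<close>, and negating the \<open>q\<close> gives another
  \<open>(-1) ^ c\<close>, so with the prefactor \<open>(-1) ^ k\<close> all signs cancel. Different
  colourings may share a monomial, so a coefficient counts pairs of a permutation and a
  colouring.\<close>

lemma signed_feray_poly:
  "(-1) ^ k * negate_q (feray_poly m k) = (\<Sum>\<rho> | \<rho> permutes {..<k}. \<Sum>\<phi>\<in>colourings m k \<rho>.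
     Poly_Mapping.single (colour_monomial k \<rho> (complement k \<rho>) \<phi>) 1)"
proof -
  define v where "v x = (case x of P i \<Rightarrow> pq_Var (P i) | Q i \<Rightarrow> - pq_Var (Q i))" for x
  have term_eq: "(-1) ^ k * (pq_Const (of_int (sign (complement k \<rho>))) *
      monomial_value v (colour_monomial k \<rho> (complement k \<rho>) \<phi>)) =
    Poly_Mapping.single (colour_monomial k \<rho> (complement k \<rho>) \<phi>) 1"
    if \<rho>: "\<rho> permutes {..<k}" for \<rho> \<phi>
  proof -
    let ?\<sigma> = "complement k \<rho>" and ?c = "card (orbits (complement k \<rho>) {..<k})"
    have "sign ?\<sigma> = (-1) ^ k * (-1) ^ ?c"
      using sign_eq_orbits[OF complement_permutes[OF \<rho>]] by simp
    moreover have "pq_Const ((-1) ^ n) = (-1) ^ n" for n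
    proof (cases "even n")
      case True
      then show ?thesis by (simp add: pq_Const_def)
    next
      case False
      have "pq_Const (-1) = -1" by (simp add: pq_Const_def single_uminus)
      with False show ?thesis by simp
    qed
    ultimately have s: "pq_Const (of_int (sign ?\<sigma>)) = (-1) ^ k * (-1) ^ ?c"
      by (simp add: power_add[symmetric])
    have "monomial_value v (colour_monomial k \<rho> ?\<sigma> \<phi>) =
      (\<Prod>X\<in>orbits \<rho> {..<k}. pq_Var (P (Max (\<phi> ` X)))) *
      ((-1) ^ ?c * (\<Prod>X\<in>orbits ?\<sigma> {..<k}. pq_Var (Q (Max (\<phi> ` X)))))"
      unfolding monomial_value_colour by (simp add: v_def prod_uminus)
    also have "\<dots> = (-1) ^ ?c * Poly_Mapping.single (colour_monomial k \<rho> ?\<sigma> \<phi>) 1"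
      unfolding prod_pq_Var by (simp add: mult_single mult.left_commute colour_monomial_def)
    finally have val: "monomial_value v (colour_monomial k \<rho> ?\<sigma> \<phi>) =
      (-1) ^ ?c * Poly_Mapping.single (colour_monomial k \<rho> ?\<sigma> \<phi>) 1" .
    have sq: "(-1) ^ n * ((-1) ^ n * a) = (a :: pq_poly)" for n a
      by (simp add: mult.assoc[symmetric] power_add[symmetric])
    show ?thesis unfolding s val by (simp add: mult.assoc sq)
  qed
  have "negate_q (feray_poly m k) = (\<Sum>\<rho> | \<rho> permutes {..<k}. \<Sum>\<phi>\<in>colourings m k \<rho>.
      pq_Const (of_int (sign (complement k \<rho>))) * monomial_value v (colour_monomial k \<rho> (complement k \<rho>) \<phi>))"
    unfolding negate_q_def feray_poly_def v_def[symmetric]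
    by (simp add: poly_subst_sum poly_subst_single pq_Const_add pq_Const_zero)
  then have "(-1) ^ k * negate_q (feray_poly m k) = (\<Sum>\<rho> | \<rho> permutes {..<k}. \<Sum>\<phi>\<in>colourings m k \<rho>.
      (-1) ^ k * (pq_Const (of_int (sign (complement k \<rho>))) *
        monomial_value v (colour_monomial k \<rho> (complement k \<rho>) \<phi>)))"
    by (simp add: sum_distrib_left)
  also have "\<dots> = (\<Sum>\<rho> | \<rho> permutes {..<k}. \<Sum>\<phi>\<in>colourings m k \<rho>.
     Poly_Mapping.single (colour_monomial k \<rho> (complement k \<rho>) \<phi>) 1)"
    by (intro sum.cong refl term_eq) simp
  finally show ?thesis .
qed

theorem corollary4p9:
  fixes m k :: nat
  assumes "1 \<le> m" and "5 \<le> k"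
  shows "pq_positive (hom_component (k - 3) ((-1) ^ k * negate_q (stanley_poly m k)))"
  unfolding stanley_poly_eqI[OF \<open>1 \<le> m\<close> is_stanley_poly_feray] signed_feray_poly
  \<comment> \<open>All coefficients of the signed polynomial are sums of zeros and ones, hence
    nonnegative in every degree, in particular in degree \<open>k - 3\<close>.\<close>
  by (rule pq_positive_hom_component)
    (auto simp: lookup_sum lookup_single when_def intro!: sum_nonneg)

end
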